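(* Let $A=\sigma(R)\langle x_1,\dots,x_n\rangle$ be a bijective skew PBW extension of an LGS ring $R$, let $m\ge1$, and let $\mathrm{Mon}(A)$ and $\mathrm{Mon}(A^m)$ be endowed with monomial orders. Let $M\neq0$ be a submodule of the free left $A$-module $A^m$ and let $G$ be a finite set of non-zero elements of $M$ that generates $M$. Then the following conditions are equivalent: (i) $G$ is a Gröbner basis of $M$. (ii) For all $F:=\{\mathbf g_1,\dots,\mathbf g_s\}\subseteq G$ with $\mathbf X_F\neq\mathbf 0$, and for any $(b_1,\dots,b_s)\in B_F$, one has $\sum_{i=1}^s b_ix^{\gamma_i}\mathbf g_i\xrightarrow{\,G\,}_+\mathbf 0$.
   Context: Rings are associative with unit; $\mathbb N$ contains $0$. Skew PBW extensions. Let $R\subseteq A$ be rings. $A$ is a skew PBW extension of $R$, written $A=\sigma(R)\langle x_1,\dots,x_n\rangle$, if: (1) there are $x_1,\dots,x_n\in A$ such that $A$ is a free left $R$-module with basis $\mathrm{Mon}(A)=\{x^\alpha=x_1^{\alpha_1}\cdots x_n^{\alpha_n}\mid \alpha\in\mathbb N^n\}$; (2) for every $i$ and $r\in R\setminus\{0\}$ there is $c_{i,r}\in R\setminus\{0\}$ with $x_ir-c_{i,r}x_i\in R$; (3) for all $1\le i,j\le n$ there is $c_{i,j}\in R\setminus\{0\}$ with $x_jx_i-c_{i,j}x_ix_j\in R+Rx_1+\cdots+Rx_n$. Then for each $i$ there are an injective ring endomorphism $\sigma_i$ of $R$ and a $\sigma_i$-derivation $\delta_i$ of $R$ with $x_ir=\sigma_i(r)x_i+\delta_i(r)$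 for all $r\in R$. $A$ is bijective if every $\sigma_i$ is bijective and $c_{i,j}$ is invertible for all $1\le i<j\le n$. Put $\sigma^\alpha:=\sigma_1^{\alpha_1}\cdots\sigma_n^{\alpha_n}$, $|\alpha|:=\alpha_1+\cdots+\alpha_n$, $\exp(x^\alpha):=\alpha$, $\deg(x^\alpha):=|\alpha|$, and for non-zero $f\in A$ let $\deg(f)$ be the maximal degree of its monomials. For $\alpha,\beta\in\mathbb N^n$ there are unique $c_{\alpha,\beta}\in R$, $p_{\alpha,\beta}\in A$ with $x^\alpha x^\beta=c_{\alpha,\beta}x^{\alpha+\beta}+p_{\alpha,\beta}$, where $p_{\alpha,\beta}=0$ or $\deg(p_{\alpha,\beta})<|\alpha+\beta|$. LGS rings. $R$ is left Gröbner soluble (LGS) if $R$ is left Noetherian; there is an algorithm deciding, for $a,r_1,\dots,r_m\in R$, whether $a\in Rr_1+\cdots+Rr_m$ and, if so, finding $b_i$ with $a=\sum b_ir_i$; and there is an algorithm computing a finite generating set of the left $R$-module $\mathrm{Syz}_R[r_1\ \cdots\ r_m]:=\{(b_1,\dots,b_m)\in R^m\mid b_1r_1+\cdots+b_mr_m=0\}$. Monomial orders on $\mathrm{Mon}(A)$. For a total order $\succeq$ on $\mathrm{Mon}(A)$, $lm(f)$ denotes the largest monomial occurring in $0\ne f\in A$. $\succeq$ is a monomial order if: $x^\beta\succeq x^\alpha$ implies $lm(x^\gamma x^\beta x^\lambda)\succeq lm(x^\gamma x^\alpha x^\lambda)$ for all $\gamma,\lambda$; $x^\alpha\succeq 1$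 for all $\alpha$; and $|\beta|>|\alpha|$ implies $x^\beta\succeq x^\alpha$. (Then $lm(x^\alpha x^\beta)=x^{\alpha+\beta}$.) Monomials of $A^m$. Let $\mathbf e_1,\dots,\mathbf e_m$ be the canonical basis of $A^m$. $\mathrm{Mon}(A^m)$ is the set of $\mathbf X=X\mathbf e_i$ with $X=x^\alpha\in\mathrm{Mon}(A)$, $1\le i\le m$; $ind(\mathbf X):=i$, $\exp(\mathbf X):=\alpha$, $\deg(\mathbf X):=|\alpha|$. The least common multiple of $X\mathbf e_i$ and $Y\mathbf e_j$ is $\mathbf 0$ if $i\ne j$ and $lcm(X,Y)\mathbf e_i$ if $i=j$ (lcm of monomials of $A$ being given by componentwise maxima of exponents); the lcm of a finite set is defined accordingly, being $\mathbf 0$ unless all indices agree. A monomial order on $\mathrm{Mon}(A^m)$ is a total order $\succeq$ such that: $lm(x^\beta x^\alpha)\mathbf e_i\succeq x^\alpha\mathbf e_i$ always; $x^\beta\mathbf e_j\succeq x^\alpha\mathbf e_i$ implies $lm(x^\gamma x^\beta)\mathbf e_j\succeq lm(x^\gamma x^\alpha)\mathbf e_i$ for all $\gamma$; and $\deg(\mathbf X)>\deg(\mathbf Y)$ implies $\mathbf X\succeq\mathbf Y$. For $\mathbf 0\ne\mathbf f=c_1\mathbf X_1+\cdots+c_t\mathbf X_t$ with $c_i\in R\setminus\{0\}$, $\mathbf X_1\succ\cdots\succ\mathbf X_t$, put $lm(\mathbf f):=\mathbf X_1$, $lc(\mathbf f):=c_1$. Reduction. Let $F$ be a finite set of non-zero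 vectors of $A^m$. $\mathbf f\xrightarrow{F}\mathbf h$ (one step) means there are $\mathbf f_1,\dots,\mathbf f_t\in F$, $r_1,\dots,r_t\in R$, $\alpha_i\in\mathbb N^n$ with $ind(lm(\mathbf f_i))=ind(lm(\mathbf f))$ and $\alpha_i+\exp(lm(\mathbf f_i))=\exp(lm(\mathbf f))$ for all $i$, $lc(\mathbf f)=\sum_i r_i\sigma^{\alpha_i}(lc(\mathbf f_i))c_{\alpha_i,\exp(lm(\mathbf f_i))}$, and $\mathbf h=\mathbf f-\sum_i r_ix^{\alpha_i}\mathbf f_i$; by convention $\mathbf 0\xrightarrow{F}\mathbf 0$. $\mathbf f\xrightarrow{F}_+\mathbf h$ means $\mathbf h$ is obtained by finitely many one-step reductions. A non-zero $\mathbf f$ is reducible w.r.t. $F$ if a one-step reduction of $\mathbf f$ by $F$ exists; otherwise (or if $\mathbf f=\mathbf 0$) it is reduced. Gröbner bases. For a submodule $M\ne0$ of $A^m$, a non-empty finite set $G$ of non-zero vectors of $M$ is a Gröbner basis for $M$ if every $\mathbf 0\neq\mathbf f\in M$ is reducible w.r.t. $G$. $\{\mathbf 0\}$ is a Gröbner basis of $M=0$. The sets $B_F$. For $F=\{\mathbf g_1,\dots,\mathbf g_s\}\subseteq A^m\setminus\{\mathbf 0\}$ let $\mathbf X_F$ be the least common multiple of $lm(\mathbf g_1),\dots,lm(\mathbf g_s)$. If $\mathbf X_F\ne\mathbf 0$, put $\beta_i:=\exp(lm(\mathbf g_i))$ and let $\gamma_i\in\mathbb N^n$ satisfy $\gamma_i+\beta_i=\exp(\mathbf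 X_F)$. $B_F$ denotes a (fixed) finite generating set of the left $R$-module $\mathrm{Syz}_R[\sigma^{\gamma_1}(lc(\mathbf g_1))c_{\gamma_1,\beta_1}\ \cdots\ \sigma^{\gamma_s}(lc(\mathbf g_s))c_{\gamma_s,\beta_s}]$. *)

theory Defs
  imports
    "HOL-Analysis.Finite_Cartesian_Product"
    "HOL-Library.Function_Algebras"
    "HOL-Library.Nat_Bijection"
begin

text \<open>
  The ring extension is given by a type \<open>'a\<close> (the ring \<open>A\<close>) and a subset \<open>R\<close> of it.  Modules over
  noncommutative rings are not covered by the module locale, so submodules are described by a set
  \<open>S\<close> of scalars and a scalar action.
\<close>

definition unital_subring :: "'a::ring_1 set \<Rightarrow> bool" where
  "unital_subring R \<longleftrightarrow>
     1 \<in> R \<and> (\<forall>a\<in>R. \<forall>b\<in>R. a - b \<in> R \<and> a * b \<in> R)"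

definition left_submodule :: "'s set \<Rightarrow> ('s \<Rightarrow> 'v \<Rightarrow> 'v) \<Rightarrow> 'v::ab_group_add set \<Rightarrow> bool" where
  "left_submodule S act N \<longleftrightarrow>
     0 \<in> N \<and> (\<forall>u\<in>N. \<forall>v\<in>N. u + v \<in> N) \<and> (\<forall>s\<in>S. \<forall>u\<in>N. act s u \<in> N)"

text \<open>Only used for finite \<open>X\<close>.\<close>

definition left_span :: "'s set \<Rightarrow> ('s \<Rightarrow> 'v \<Rightarrow> 'v) \<Rightarrow> 'v::comm_monoid_add set \<Rightarrow> 'v set" where
  "left_span S act X = {\<Sum>v\<in>X. act (c v) v |c. \<forall>v\<in>X. c v \<in> S}"

definition left_noetherian :: "'a::ring_1 set \<Rightarrow> bool" where
  "left_noetherian R \<longleftrightarrow>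
     (\<forall>I\<subseteq>R. left_submodule R (*) I \<longrightarrow> (\<exists>X\<subseteq>I. finite X \<and> I = left_span R (*) X))"

text \<open>
  A family \<open>(b\<^sub>i)\<close>, \<open>i \<in> I\<close>, of elements of \<open>R\<close> is a function that vanishes outside \<open>I\<close>; the free
  module of these families carries the pointwise operations.
\<close>

definition Syz :: "'a::ring_1 set \<Rightarrow> 'i set \<Rightarrow> ('i \<Rightarrow> 'a) \<Rightarrow> ('i \<Rightarrow> 'a) set" where
  "Syz R I r = {b. (\<forall>i\<in>I. b i \<in> R) \<and> (\<forall>i. i \<notin> I \<longrightarrow> b i = 0) \<and> (\<Sum>i\<in>I. b i * r i) = 0}"

definition scale_family :: "'a::ring_1 \<Rightarrow> ('i \<Rightarrow> 'a) \<Rightarrow> 'i \<Rightarrow> 'a" where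
  "scale_family a b = (\<lambda>i. a * b i)"

text \<open>Algorithms are the mu-recursive functions; \<open>computes p ins out\<close> says that \<open>p\<close> halts on the
  inputs \<open>ins\<close> with output \<open>out\<close>.\<close>

datatype recf = Zero | Succ | Proj nat | Comp recf "recf list" | PrimRec recf recf | Mu recf

inductive computes :: "recf \<Rightarrow> nat list \<Rightarrow> nat \<Rightarrow> bool" where
  "computes Zero ks 0"
| "computes Succ (k # ks) (Suc k)"
| "i < length ks \<Longrightarrow> computes (Proj i) ks (ks ! i)"
| "length ls = length gs \<Longrightarrow> (\<forall>i<length gs. computes (gs ! i) ks (ls ! i)) \<Longrightarrow>
     computes f ls y \<Longrightarrow> computes (Comp f gs) ks y"
| "computes f ks y \<Longrightarrow> computes (PrimRec f g) (0 # ks) y"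
| "computes (PrimRec f g) (k # ks) y \<Longrightarrow> computes g (k # y # ks) z \<Longrightarrow>
     computes (PrimRec f g) (Suc k # ks) z"
| "computes f (k # ks) 0 \<Longrightarrow> (\<forall>j<k. \<exists>y. computes f (j # ks) (Suc y)) \<Longrightarrow>
     computes (Mu f) ks k"

text \<open>
  Elements of \<open>R\<close> are presented to an algorithm by the codes \<open>enc r\<close>.
  A membership algorithm receives \<open>a\<close> and \<open>[r\<^sub>1, \<dots>, r\<^sub>m]\<close>; its output is \<open>0\<close> if
  \<open>a\<close> is not in \<open>R r\<^sub>1 + \<dots> + R r\<^sub>m\<close>, and otherwise the successor of the code of a list
  of coefficients.
\<close>

definition membership_algorithm :: "'a::ring_1 set \<Rightarrow> ('a \<Rightarrow> nat) \<Rightarrow> recf \<Rightarrow> bool" where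
  "membership_algorithm R enc p \<longleftrightarrow>
     (\<forall>a\<in>R. \<forall>rs\<in>lists R.
        let sols = {bs \<in> lists R. length bs = length rs \<and> a = (\<Sum>i<length rs. bs ! i * rs ! i)};
            ins = [enc a, list_encode (map enc rs)]
        in if sols = {} then computes p ins 0
           else \<exists>bs\<in>sols. computes p ins (Suc (list_encode (map enc bs))))"

definition syzygy_algorithm :: "'a::ring_1 set \<Rightarrow> ('a \<Rightarrow> nat) \<Rightarrow> recf \<Rightarrow> bool" where
  "syzygy_algorithm R enc p \<longleftrightarrow>
     (\<forall>rs\<in>lists R. \<exists>bss\<in>lists (lists R).
        (\<forall>bs\<in>set bss. length bs = length rs) \<and>
        left_span R scale_family ((\<lambda>bs i. if i < length rs then bs ! i else 0) ` set bss)
          = Syz R {..<length rs} (\<lambda>i. rs ! i) \<and>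
        computes p [list_encode (map enc rs)]
          (list_encode (map (\<lambda>bs. list_encode (map enc bs)) bss)))"

definition left_groebner_soluble :: "'a::ring_1 set \<Rightarrow> bool" where
  "left_groebner_soluble R \<longleftrightarrow> left_noetherian R \<and>
     (\<exists>enc. inj_on enc R \<and> (\<exists>p. membership_algorithm R enc p) \<and> (\<exists>q. syzygy_algorithm R enc q))"

text \<open>
  The variables are \<open>x 0, \<dots>, x (n - 1)\<close>.  A monomial is represented by its exponent, an element of
  \<open>\<nat>\<^sup>n\<close> encoded as a function on the naturals vanishing from \<open>n\<close> on; exponents are added and
  subtracted pointwise.
\<close>

type_synonym expo = "nat \<Rightarrow> nat"

definition exponents :: "nat \<Rightarrow> expo set" where
  "exponents n = {\<alpha>. \<forall>i\<ge>n. \<alpha> i = 0}"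

definition total_degree :: "nat \<Rightarrow> expo \<Rightarrow> nat" where
  "total_degree n \<alpha> = (\<Sum>i<n. \<alpha> i)"

definition pbw_mon :: "nat \<Rightarrow> (nat \<Rightarrow> 'a::ring_1) \<Rightarrow> expo \<Rightarrow> 'a" where
  "pbw_mon n x \<alpha> = (\<Prod>i\<leftarrow>[0..<n]. x i ^ \<alpha> i)"

context
  fixes R :: "'a::ring_1 set" and n :: nat and x :: "nat \<Rightarrow> 'a"
begin

definition pbw_expansion :: "'a \<Rightarrow> (expo \<Rightarrow> 'a) \<Rightarrow> bool" where
  "pbw_expansion f k \<longleftrightarrow>
     (\<forall>\<alpha>. k \<alpha> \<in> R) \<and> {\<alpha>. k \<alpha> \<noteq> 0} \<subseteq> exponents n \<and> finite {\<alpha>. k \<alpha> \<noteq> 0} \<and>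
     f = (\<Sum>\<alpha> | k \<alpha> \<noteq> 0. k \<alpha> * pbw_mon n x \<alpha>)"

definition affine_forms :: "'a set" where
  "affine_forms = {r + (\<Sum>k<n. s k * x k) |r s. r \<in> R \<and> (\<forall>k<n. s k \<in> R)}"

definition skew_pbw_extension :: bool where
  "skew_pbw_extension \<longleftrightarrow>
     unital_subring R \<and>
     (\<forall>f. \<exists>!k. pbw_expansion f k) \<and>
     (\<forall>i<n. \<forall>r\<in>R - {0}. \<exists>c\<in>R - {0}. x i * r - c * x i \<in> R) \<and>
     (\<forall>i<n. \<forall>j<n. \<exists>c\<in>R - {0}. x j * x i - c * x i * x j \<in> affine_forms)"

definition pbw_sigma :: "nat \<Rightarrow> 'a \<Rightarrow> 'a" where
  "pbw_sigma i r = (THE s. s \<in> R \<and> (\<exists>d\<in>R. x i * r = s * x i + d))"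

text \<open>Well defined for \<open>i < j\<close>, where \<open>x i * x j\<close> is a basis monomial.\<close>

definition pbw_commutation_coeff :: "nat \<Rightarrow> nat \<Rightarrow> 'a" where
  "pbw_commutation_coeff i j =
     (THE c. c \<in> R - {0} \<and> x j * x i - c * x i * x j \<in> affine_forms)"

definition bijective_skew_pbw_extension :: bool where
  "bijective_skew_pbw_extension \<longleftrightarrow>
     skew_pbw_extension \<and>
     (\<forall>i<n. bij_betw (pbw_sigma i) R R) \<and>
     (\<forall>j<n. \<forall>i<j. \<exists>d\<in>R. pbw_commutation_coeff i j * d = 1 \<and> d * pbw_commutation_coeff i j = 1)"

text \<open>\<open>\<sigma>\<^sup>\<alpha>\<close> is the composition with the powers of the first endomorphism applied last.\<close>

definition pbw_sigma_pow :: "expo \<Rightarrow> 'a \<Rightarrow> 'a" where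
  "pbw_sigma_pow \<alpha> = foldr (\<lambda>i. pbw_sigma i ^^ \<alpha> i) [0..<n]"

definition pbw_coeff :: "'a \<Rightarrow> expo \<Rightarrow> 'a" where
  "pbw_coeff f = (THE k. pbw_expansion f k)"

definition pbw_support :: "'a \<Rightarrow> expo set" where
  "pbw_support f = {\<alpha>. pbw_coeff f \<alpha> \<noteq> 0}"

definition pbw_deg :: "'a \<Rightarrow> nat" where
  "pbw_deg f = Max (total_degree n ` pbw_support f)"

definition pbw_c :: "expo \<Rightarrow> expo \<Rightarrow> 'a" where
  "pbw_c \<alpha> \<beta> = (THE c. c \<in> R \<and>
     (\<exists>p. pbw_mon n x \<alpha> * pbw_mon n x \<beta> = c * pbw_mon n x (\<alpha> + \<beta>) + p \<and>
          (p = 0 \<or> pbw_deg p < total_degree n (\<alpha> + \<beta>))))"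

text \<open>Orders are sets of pairs with the smaller element first.\<close>

definition pbw_lm :: "expo rel \<Rightarrow> 'a \<Rightarrow> expo" where
  "pbw_lm ord f = (THE \<alpha>. \<alpha> \<in> pbw_support f \<and> (\<forall>\<beta>\<in>pbw_support f. (\<beta>, \<alpha>) \<in> ord))"

definition pbw_monomial_order :: "expo rel \<Rightarrow> bool" where
  "pbw_monomial_order ord \<longleftrightarrow>
     linear_order_on (exponents n) ord \<and>
     (\<forall>\<alpha> \<beta>. (\<alpha>, \<beta>) \<in> ord \<longrightarrow> (\<forall>\<gamma>\<in>exponents n. \<forall>\<delta>\<in>exponents n.
        (pbw_lm ord (pbw_mon n x \<gamma> * pbw_mon n x \<alpha> * pbw_mon n x \<delta>),
         pbw_lm ord (pbw_mon n x \<gamma> * pbw_mon n x \<beta> * pbw_mon n x \<delta>)) \<in> ord)) \<and>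
     (\<forall>\<alpha>\<in>exponents n. (0, \<alpha>) \<in> ord) \<and>
     (\<forall>\<alpha>\<in>exponents n. \<forall>\<beta>\<in>exponents n.
        total_degree n \<alpha> < total_degree n \<beta> \<longrightarrow> (\<alpha>, \<beta>) \<in> ord)"

text \<open>The monomial \<open>x\<^sup>\<alpha> e\<^sub>i\<close> of \<open>A\<^sup>m\<close> is the pair \<open>(\<alpha>, i)\<close>.\<close>

definition pbw_vec_monomial_order :: "expo rel \<Rightarrow> (expo \<times> 'm) rel \<Rightarrow> bool" where
  "pbw_vec_monomial_order ord vord \<longleftrightarrow>
     linear_order_on (exponents n \<times> UNIV) vord \<and>
     (\<forall>\<alpha>\<in>exponents n. \<forall>\<beta>\<in>exponents n. \<forall>i.
        ((\<alpha>, i), (pbw_lm ord (pbw_mon n x \<beta> * pbw_mon n x \<alpha>), i)) \<in> vord) \<and>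
     (\<forall>\<alpha> i \<beta> j. ((\<alpha>, i), (\<beta>, j)) \<in> vord \<longrightarrow> (\<forall>\<gamma>\<in>exponents n.
        ((pbw_lm ord (pbw_mon n x \<gamma> * pbw_mon n x \<alpha>), i),
         (pbw_lm ord (pbw_mon n x \<gamma> * pbw_mon n x \<beta>), j)) \<in> vord)) \<and>
     (\<forall>\<alpha>\<in>exponents n. \<forall>\<beta>\<in>exponents n. \<forall>i j.
        total_degree n \<alpha> < total_degree n \<beta> \<longrightarrow> ((\<alpha>, i), (\<beta>, j)) \<in> vord)"

definition vec_coeff :: "'a ^ 'm \<Rightarrow> expo \<times> 'm \<Rightarrow> 'a" where
  "vec_coeff f X = pbw_coeff (f $ snd X) (fst X)"

definition vec_lm :: "(expo \<times> 'm) rel \<Rightarrow> 'a ^ 'm \<Rightarrow> expo \<times> 'm" where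
  "vec_lm vord f = (THE X. vec_coeff f X \<noteq> 0 \<and> (\<forall>Y. vec_coeff f Y \<noteq> 0 \<longrightarrow> (Y, X) \<in> vord))"

definition vec_lc :: "(expo \<times> 'm) rel \<Rightarrow> 'a ^ 'm \<Rightarrow> 'a" where
  "vec_lc vord f = vec_coeff f (vec_lm vord f)"

text \<open>A reduction step uses a finite list of triples \<open>(f\<^sub>i, r\<^sub>i, \<alpha>\<^sub>i)\<close>.\<close>

definition reduction_step ::
    "(expo \<times> 'm) rel \<Rightarrow> ('a ^ 'm) set \<Rightarrow> 'a ^ 'm \<Rightarrow> 'a ^ 'm \<Rightarrow> bool" where
  "reduction_step vord F f h \<longleftrightarrow>
     (f = 0 \<and> h = 0) \<or>
     (f \<noteq> 0 \<and> (\<exists>ts :: (('a ^ 'm) \<times> 'a \<times> expo) list.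
        (\<forall>(g, r, \<alpha>)\<in>set ts.
           g \<in> F \<and> r \<in> R \<and> \<alpha> \<in> exponents n \<and>
           snd (vec_lm vord g) = snd (vec_lm vord f) \<and>
           \<alpha> + fst (vec_lm vord g) = fst (vec_lm vord f)) \<and>
        vec_lc vord f =
          (\<Sum>(g, r, \<alpha>)\<leftarrow>ts. r * pbw_sigma_pow \<alpha> (vec_lc vord g) * pbw_c \<alpha> (fst (vec_lm vord g))) \<and>
        h = f - (\<Sum>(g, r, \<alpha>)\<leftarrow>ts. (r * pbw_mon n x \<alpha>) *s g)))"

definition reduces :: "(expo \<times> 'm) rel \<Rightarrow> ('a ^ 'm) set \<Rightarrow> 'a ^ 'm \<Rightarrow> 'a ^ 'm \<Rightarrow> bool" where
  "reduces vord F = (reduction_step vord F)\<^sup>+\<^sup>+"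

definition reducible :: "(expo \<times> 'm) rel \<Rightarrow> ('a ^ 'm) set \<Rightarrow> 'a ^ 'm \<Rightarrow> bool" where
  "reducible vord F f \<longleftrightarrow> f \<noteq> 0 \<and> (\<exists>h. reduction_step vord F f h)"

definition groebner_basis :: "(expo \<times> 'm) rel \<Rightarrow> ('a ^ 'm) set \<Rightarrow> ('a ^ 'm) set \<Rightarrow> bool" where
  "groebner_basis vord G M \<longleftrightarrow>
     (if M = {0} then G = {0}
      else G \<noteq> {} \<and> finite G \<and> G \<subseteq> M - {0} \<and> (\<forall>f\<in>M - {0}. reducible vord G f))"

text \<open>\<open>None\<close> is the least common multiple \<open>0\<close>; it is also the value for the empty set.\<close>

definition mon_lcm :: "(expo \<times> 'm) set \<Rightarrow> (expo \<times> 'm) option" where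
  "mon_lcm S =
     (if \<exists>i. snd ` S = {i}
      then Some (\<lambda>k. Max ((\<lambda>X. fst X k) ` S), the_elem (snd ` S))
      else None)"

definition critical_lcm :: "(expo \<times> 'm) rel \<Rightarrow> ('a ^ 'm) set \<Rightarrow> (expo \<times> 'm) option" where
  "critical_lcm vord F = mon_lcm (vec_lm vord ` F)"

text \<open>For \<open>g \<in> F\<close> the exponent of \<open>lm g\<close> is pointwise below that of the least common multiple, so
  the subtraction is not truncated.\<close>

definition cofactor_exp :: "(expo \<times> 'm) rel \<Rightarrow> ('a ^ 'm) set \<Rightarrow> 'a ^ 'm \<Rightarrow> expo" where
  "cofactor_exp vord F g = fst (the (critical_lcm vord F)) - fst (vec_lm vord g)"

text \<open>The syzygies are indexed by the elements of \<open>F\<close> rather than by an enumeration of \<open>F\<close>.\<close>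

definition critical_syz :: "(expo \<times> 'm) rel \<Rightarrow> ('a ^ 'm) set \<Rightarrow> ('a ^ 'm \<Rightarrow> 'a) set" where
  "critical_syz vord F = Syz R F
     (\<lambda>g. pbw_sigma_pow (cofactor_exp vord F g) (vec_lc vord g)
          * pbw_c (cofactor_exp vord F g) (fst (vec_lm vord g)))"

end

end

theory Submission imports Defs
begin

text \<open>
  Let \<open>f = \<Sum> r x\<^sup>\<alpha> g\<close> be an element of \<open>M\<close>, written with generators \<open>g \<in> G\<close>.  Call the largest of the
  monomials \<open>x\<^sup>\<alpha> lm(g)\<close> the height of the representation.  If the terms of maximal height \<open>X\<close> do not
  cancel, then \<open>lm(f) = X\<close>, and these terms are a reduction step for \<open>f\<close>.  If they cancel, their
  coefficients form a relation between the elements \<open>\<sigma>\<^sup>\<alpha>(lc g) c\<^bsub>\<alpha>,\<beta>\<^esub>\<close> of \<open>R\<close>, where \<open>\<beta> = exp(lm g)\<close>.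
  The criterion allows such a representation to be replaced by one of smaller height
  (\<open>cancel_top\<close>), and as only finitely many monomials lie below a given one, every
  non-zero \<open>f \<in> M\<close> ends up in the first case (\<open>combination_reducible\<close>).

  To remove a cancellation, let \<open>F\<close> be the set of all \<open>g \<in> G\<close> whose leading monomial divides \<open>X\<close>, and let
  \<open>X = x\<^sup>\<delta> X\<^sub>F\<close>.  Associativity of \<open>A\<close> gives a cocycle identity between the \<open>c\<^bsub>\<alpha>,\<beta>\<^esub>\<close> and the \<open>\<sigma>\<^sup>\<alpha>\<close>
  (\<open>cocycle\<close>).  Since the \<open>c\<^bsub>\<alpha>,\<beta>\<^esub>\<close> are units and \<open>\<sigma>\<^sup>\<delta>\<close> is bijective on \<open>R\<close>, this identity turns the
  relation at \<open>X\<close> into \<open>\<sigma>\<^sup>\<delta>\<close> of a syzygy at \<open>X\<^sub>F\<close>.  That syzygy is a combination of the elements \<open>b\<close> of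
  \<open>B\<^sub>F\<close>, and each vector \<open>\<Sum> b\<^sub>g x\<^bsup>\<gamma>\<^esup> g\<close> has a representation of height below \<open>X\<^sub>F\<close>, because the sequence of
  reductions to zero provides one.  Multiplication by \<open>x\<^sup>\<delta>\<close> carries these representations to height
  below \<open>X\<close>.

  Everything rests on products of monomials having the expected leading term: \<open>x\<^sup>\<alpha> x\<^sup>\<beta>\<close> equals
  \<open>c\<^bsub>\<alpha>,\<beta>\<^esub> x\<^bsup>\<alpha>+\<beta>\<^esup>\<close> with a unit \<open>c\<^bsub>\<alpha>,\<beta>\<^esub>\<close>, and \<open>x\<^sup>\<alpha> r\<close> equals \<open>\<sigma>\<^sup>\<alpha>(r) x\<^sup>\<alpha>\<close>, up to terms of smaller degree
  (\<open>x_mult_mon\<close>, \<open>pbw_c\<close>, \<open>mon_mult_R\<close>).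

  In the other direction, reduction by a Groebner basis stays inside \<open>M\<close> and lowers the leading monomial,
  so it can only stop at zero (\<open>groebner_reduces_to_0\<close>).
\<close>

section \<open>Exponents\<close>

definition unit_exp :: "nat \<Rightarrow> expo" where
  "unit_exp i = (\<lambda>j. if j = i then 1 else 0)"

lemma exponents_0 [simp]: "0 \<in> exponents n"
  by (simp add: exponents_def)

lemma exponents_add [simp]: "\<alpha> \<in> exponents n \<Longrightarrow> \<beta> \<in> exponents n \<Longrightarrow> \<alpha> + \<beta> \<in> exponents n"
  by (simp add: exponents_def)

lemma exponents_diff [simp]: "\<alpha> \<in> exponents n \<Longrightarrow> \<alpha> - \<beta> \<in> exponents n"
  by (simp add: exponents_def)

lemma unit_exp_exponents [simp]: "i < n \<Longrightarrow> unit_exp i \<in> exponents n"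
  by (simp add: exponents_def unit_exp_def)

lemma total_degree_0 [simp]: "total_degree n 0 = 0"
  by (simp add: total_degree_def)

lemma total_degree_add [simp]: "total_degree n (\<alpha> + \<beta>) = total_degree n \<alpha> + total_degree n \<beta>"
  by (simp add: total_degree_def sum.distrib)

lemma total_degree_unit_exp [simp]: "i < n \<Longrightarrow> total_degree n (unit_exp i) = 1"
  by (simp add: total_degree_def unit_exp_def)

lemma finite_bounded_exponents: "finite {\<alpha> \<in> exponents n. total_degree n \<alpha> \<le> d}"
proof (rule finite_subset)
  show "{\<alpha> \<in> exponents n. total_degree n \<alpha> \<le> d}
      \<subseteq> {\<alpha>. \<forall>i. (i \<in> {..<n} \<longrightarrow> \<alpha> i \<in> {..d}) \<and> (i \<notin> {..<n} \<longrightarrow> \<alpha> i = 0)}"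
  proof clarsimp
    fix \<alpha> i assume a: "\<alpha> \<in> exponents n" and d: "total_degree n \<alpha> \<le> d"
    have "\<alpha> i \<le> total_degree n \<alpha>" if "i < n"
      unfolding total_degree_def using that by (intro member_le_sum) auto
    with a d show "(i < n \<longrightarrow> \<alpha> i \<le> d) \<and> (\<not> i < n \<longrightarrow> \<alpha> i = 0)"
      by (auto simp: exponents_def)
  qed
qed (rule finite_set_of_finite_funs; simp)

text \<open>Peeling off the variable of smallest index keeps the remaining product in standard order:
  \<open>x\<^sub>i x\<^sup>\<alpha>\<close> is a basis monomial as long as \<open>\<alpha>\<close> does not involve the variables before \<open>x\<^sub>i\<close>.\<close>

lemma exponents_induct [consumes 1, case_names zero add]:
  assumes "\<alpha> \<in> exponents n" and "P 0"
    and step: "\<And>i \<alpha>. i < n \<Longrightarrow> \<alpha> \<in> exponents n \<Longrightarrow> \<forall>j<i. \<alpha> j = 0 \<Longrightarrow> P \<alpha> \<Longrightarrow> P (unit_exp i + \<alpha>)"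
  shows "P \<alpha>"
  using assms(1)
proof (induction "total_degree n \<alpha>" arbitrary: \<alpha>)
  case 0
  then have "\<alpha> = 0"
    by (auto simp: total_degree_def exponents_def fun_eq_iff) (metis lessThan_iff not_less)
  with assms(2) show ?case by (simp only:)
next
  case (Suc d)
  have ex: "\<exists>i. \<alpha> i \<noteq> 0"
  proof (rule ccontr)
    assume "\<nexists>i. \<alpha> i \<noteq> 0"
    then have "\<alpha> = 0" by (simp add: fun_eq_iff)
    with Suc.hyps(2) show False by simp
  qed
  define i where "i = (LEAST i. \<alpha> i \<noteq> 0)"
  have i: "\<alpha> i \<noteq> 0" unfolding i_def using ex by (rule LeastI_ex)
  have below: "\<forall>j<i. \<alpha> j = 0" unfolding i_def using not_less_Least by blast
  have "i < n"
  proof (rule ccontr)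
    assume "\<not> i < n"
    then have "n \<le> i" by simp
    with i Suc.prems show False by (simp add: exponents_def)
  qed
  have eq: "\<alpha> = unit_exp i + (\<alpha> - unit_exp i)"
    using i by (simp add: unit_exp_def fun_eq_iff)
  have "total_degree n \<alpha> = 1 + total_degree n (\<alpha> - unit_exp i)"
    using \<open>i < n\<close> by (subst eq) simp
  with Suc have "P (\<alpha> - unit_exp i)" by simp
  then have "P (unit_exp i + (\<alpha> - unit_exp i))"
    using \<open>i < n\<close> below Suc.prems by (intro step) auto
  then show ?case by (simp only: eq[symmetric])
qed

lemma exponents_cases:
  assumes "\<alpha> \<in> exponents n"
  obtains "\<alpha> = 0"
    | i \<beta> where "i < n" "\<beta> \<in> exponents n" "\<forall>j<i. \<beta> j = 0" "\<alpha> = unit_exp i + \<beta>"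
proof -
  have "\<alpha> = 0 \<or> (\<exists>i \<beta>. i < n \<and> \<beta> \<in> exponents n \<and> (\<forall>j<i. \<beta> j = 0) \<and> \<alpha> = unit_exp i + \<beta>)"
    using assms by (induction rule: exponents_induct) blast+
  with that show thesis by blast
qed

lemma upt_split: "i < n \<Longrightarrow> [0..<n] = [0..<i] @ i # [Suc i..<n]"
  using upt_add_eq_append[of 0 i "n - i"] by (simp add: upt_conv_Cons)

lemma pbw_mon_0 [simp]: "pbw_mon n x 0 = 1"
  unfolding pbw_mon_def by (induction n) simp_all

lemma pbw_mon_unit_exp_add:
  assumes "i < n" and "\<forall>j<i. \<alpha> j = 0"
  shows "pbw_mon n x (unit_exp i + \<alpha>) = x i * pbw_mon n x \<alpha>"
proof -
  let ?p = "\<lambda>\<beta> js. \<Prod>j\<leftarrow>js. x j ^ \<beta> j"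
  have one: "?p \<beta> [0..<i] = 1" if "\<forall>j<i. \<beta> j = 0" for \<beta>
  proof -
    have "?p \<beta> js = 1" if "\<forall>j\<in>set js. \<beta> j = 0" for js
      using that by (induction js) simp_all
    with that show ?thesis by simp
  qed
  have tail: "map (\<lambda>j. x j ^ (unit_exp i + \<alpha>) j) [Suc i..<n] = map (\<lambda>j. x j ^ \<alpha> j) [Suc i..<n]"
    by (auto simp: unit_exp_def)
  have "?p (unit_exp i + \<alpha>) [0..<n] = x i ^ Suc (\<alpha> i) * ?p \<alpha> [Suc i..<n]"
    unfolding upt_split[OF assms(1)] map_append prod_list.append
    using one[of "unit_exp i + \<alpha>"] assms(2)
    by (simp add: tail del: plus_fun_apply) (simp add: unit_exp_def)
  moreover have "?p \<alpha> [0..<n] = x i ^ \<alpha> i * ?p \<alpha> [Suc i..<n]"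
    unfolding upt_split[OF assms(1)] map_append prod_list.append
    using one[OF assms(2)] by simp
  ultimately show ?thesis by (simp add: pbw_mon_def mult.assoc)
qed

lemma pbw_mon_unit_exp [simp]: "i < n \<Longrightarrow> pbw_mon n x (unit_exp i) = x i"
  using pbw_mon_unit_exp_add[of i n 0 x] by simp

lemma pbw_sigma_pow_0 [simp]: "pbw_sigma_pow R n x 0 r = r"
proof -
  have "foldr (\<lambda>i. pbw_sigma R x i ^^ 0 i) js r = r" for js by (induction js) simp_all
  then show ?thesis by (simp add: pbw_sigma_pow_def)
qed

lemma pbw_sigma_pow_unit_exp_add:
  assumes "i < n" and "\<forall>j<i. \<alpha> j = 0"
  shows "pbw_sigma_pow R n x (unit_exp i + \<alpha>) r = pbw_sigma R x i (pbw_sigma_pow R n x \<alpha> r)"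
proof -
  let ?p = "\<lambda>\<beta>. foldr (\<lambda>j. pbw_sigma R x j ^^ \<beta> j)"
  have one: "?p \<beta> js s = s" if "\<forall>j\<in>set js. \<beta> j = 0" for \<beta> s js
    using that by (induction js) simp_all
  have tail: "?p (unit_exp i + \<alpha>) [Suc i..<n] r = ?p \<alpha> [Suc i..<n] r"
    by (intro foldr_cong) (auto simp: unit_exp_def)
  have "?p (unit_exp i + \<alpha>) [0..<n] r = (pbw_sigma R x i ^^ Suc (\<alpha> i)) (?p \<alpha> [Suc i..<n] r)"
    unfolding upt_split[OF assms(1)] foldr_append foldr.simps comp_def
    using one[of "[0..<i]" "unit_exp i + \<alpha>"] assms(2) tail by (simp add: unit_exp_def)
  moreover have "?p \<alpha> [0..<n] r = (pbw_sigma R x i ^^ \<alpha> i) (?p \<alpha> [Suc i..<n] r)"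
    unfolding upt_split[OF assms(1)] foldr_append foldr.simps comp_def
    using one[of "[0..<i]" \<alpha>] assms(2) by simp
  ultimately show ?thesis by (simp add: pbw_sigma_pow_def)
qed


text \<open>From here on exponents are added as elements of a monoid; evaluating sums pointwise would take the
  arguments of \<^term>\<open>pbw_mon n x\<close> apart.\<close>

declare plus_fun_apply [simp del] zero_fun_apply [simp del]

section \<open>Coefficients with respect to the monomial basis\<close>

locale skew_pbw =
  fixes R :: "'a::ring_1 set" and n :: nat and x :: "nat \<Rightarrow> 'a"
  assumes skew_pbw: "skew_pbw_extension R n x"
begin

abbreviation "E \<equiv> exponents n"
abbreviation "deg \<equiv> total_degree n"
abbreviation "mon \<equiv> pbw_mon n x"
abbreviation "coeff \<equiv> pbw_coeff R n x"
abbreviation "\<sigma> \<equiv> pbw_sigma R x"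
abbreviation "\<sigma>pow \<equiv> pbw_sigma_pow R n x"
abbreviation "cc \<equiv> pbw_c R n x"

lemma R_1 [simp]: "1 \<in> R" and R_diff [simp]: "a \<in> R \<Longrightarrow> b \<in> R \<Longrightarrow> a - b \<in> R"
  and R_mult [simp]: "a \<in> R \<Longrightarrow> b \<in> R \<Longrightarrow> a * b \<in> R"
  using skew_pbw by (auto simp: skew_pbw_extension_def unital_subring_def)

lemma R_0 [simp]: "0 \<in> R"
  using R_diff[OF R_1 R_1] by simp

lemma R_neg [simp]: "a \<in> R \<Longrightarrow> - a \<in> R"
  using R_diff[OF R_0, of a] by simp

lemma R_add [simp]: "a \<in> R \<Longrightarrow> b \<in> R \<Longrightarrow> a + b \<in> R"
  using R_diff[of a "- b"] by simp

lemma R_sum: "(\<And>i. i \<in> I \<Longrightarrow> f i \<in> R) \<Longrightarrow> sum f I \<in> R"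
  by (induction I rule: infinite_finite_induct) auto

lemma ex1_expansion: "\<exists>!k. pbw_expansion R n x f k"
  using skew_pbw unfolding skew_pbw_extension_def by (elim conjE) (erule spec)

lemma expansion_coeff: "pbw_expansion R n x f (coeff f)"
  unfolding pbw_coeff_def using ex1_expansion by (rule theI')

lemma coeff_unique: "pbw_expansion R n x f k \<Longrightarrow> coeff f = k"
  unfolding pbw_coeff_def using ex1_expansion by (rule the1_equality)

lemma coeff_R [simp]: "coeff f \<alpha> \<in> R"
  using expansion_coeff[of f] unfolding pbw_expansion_def by blast

lemma coeff_E: "coeff f \<alpha> \<noteq> 0 \<Longrightarrow> \<alpha> \<in> E"
  using expansion_coeff[of f] unfolding pbw_expansion_def by blast

lemma finite_support [simp]: "finite {\<alpha>. coeff f \<alpha> \<noteq> 0}"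
  using expansion_coeff[of f] unfolding pbw_expansion_def by blast

lemma expand: "f = (\<Sum>\<alpha> | coeff f \<alpha> \<noteq> 0. coeff f \<alpha> * mon \<alpha>)"
  using expansion_coeff[of f] unfolding pbw_expansion_def by blast

lemma coeff_sum_mon:
  assumes "finite S" "S \<subseteq> E" "\<And>\<alpha>. \<alpha> \<in> S \<Longrightarrow> k \<alpha> \<in> R"
  shows "coeff (\<Sum>\<alpha>\<in>S. k \<alpha> * mon \<alpha>) \<beta> = (if \<beta> \<in> S then k \<beta> else 0)"
proof -
  let ?k = "\<lambda>\<alpha>. if \<alpha> \<in> S then k \<alpha> else 0"
  have sub: "{\<alpha>. ?k \<alpha> \<noteq> 0} \<subseteq> S" by auto
  have "(\<Sum>\<alpha>\<in>S. k \<alpha> * mon \<alpha>) = (\<Sum>\<alpha>\<in>S. ?k \<alpha> * mon \<alpha>)" by (intro sum.cong) auto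
  also have "\<dots> = (\<Sum>\<alpha> | ?k \<alpha> \<noteq> 0. ?k \<alpha> * mon \<alpha>)"
    by (rule sum.mono_neutral_right[OF assms(1) sub]) auto
  finally have "pbw_expansion R n x (\<Sum>\<alpha>\<in>S. k \<alpha> * mon \<alpha>) ?k"
    unfolding pbw_expansion_def using assms sub finite_subset[OF sub assms(1)] by auto
  from coeff_unique[OF this] show ?thesis by simp
qed

lemma expand_superset:
  assumes "finite S" "{\<alpha>. coeff f \<alpha> \<noteq> 0} \<subseteq> S"
  shows "f = (\<Sum>\<alpha>\<in>S. coeff f \<alpha> * mon \<alpha>)"
  by (subst expand[of f], rule sum.mono_neutral_left[OF assms]) auto

lemma coeff_add [simp]: "coeff (f + g) \<alpha> = coeff f \<alpha> + coeff g \<alpha>"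
proof -
  let ?S = "{\<alpha>. coeff f \<alpha> \<noteq> 0} \<union> {\<alpha>. coeff g \<alpha> \<noteq> 0}"
  have "f + g = (\<Sum>\<alpha>\<in>?S. (coeff f \<alpha> + coeff g \<alpha>) * mon \<alpha>)"
    unfolding distrib_right sum.distrib
    by (intro arg_cong2[of _ _ _ _ "(+)"] expand_superset) auto
  moreover have "coeff (\<Sum>\<alpha>\<in>?S. (coeff f \<alpha> + coeff g \<alpha>) * mon \<alpha>) \<alpha> = coeff f \<alpha> + coeff g \<alpha>"
    by (subst coeff_sum_mon) (auto dest: coeff_E)
  ultimately show ?thesis by simp
qed

lemma coeff_scale [simp]: "r \<in> R \<Longrightarrow> coeff (r * f) \<alpha> = r * coeff f \<alpha>"
proof -
  assume r: "r \<in> R"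
  let ?S = "{\<alpha>. coeff f \<alpha> \<noteq> 0}"
  have "r * f = (\<Sum>\<alpha>\<in>?S. (r * coeff f \<alpha>) * mon \<alpha>)"
    by (subst expand[of f]) (simp add: sum_distrib_left mult.assoc)
  moreover have "coeff (\<Sum>\<alpha>\<in>?S. (r * coeff f \<alpha>) * mon \<alpha>) \<alpha> = r * coeff f \<alpha>"
    using r by (subst coeff_sum_mon) (auto dest: coeff_E)
  ultimately show ?thesis by simp
qed

lemma coeff_0 [simp]: "coeff 0 \<alpha> = 0"
  using coeff_scale[of 0 0 \<alpha>] by simp

lemma coeff_neg [simp]: "coeff (- f) \<alpha> = - coeff f \<alpha>"
  using coeff_scale[of "- 1" f \<alpha>] by simp

lemma coeff_diff [simp]: "coeff (f - g) \<alpha> = coeff f \<alpha> - coeff g \<alpha>"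
  using coeff_add[of f "- g" \<alpha>] by simp

lemma coeff_sum [simp]: "coeff (\<Sum>i\<in>I. f i) \<alpha> = (\<Sum>i\<in>I. coeff (f i) \<alpha>)"
  by (induction I rule: infinite_finite_induct) auto

lemma coeff_mon: "\<alpha> \<in> E \<Longrightarrow> coeff (mon \<alpha>) \<beta> = (if \<beta> = \<alpha> then 1 else 0)"
  using coeff_sum_mon[of "{\<alpha>}" "\<lambda>_. 1" \<beta>] by simp

lemma eq_0_iff_coeff: "f = 0 \<longleftrightarrow> (\<forall>\<alpha>. coeff f \<alpha> = 0)"
proof (intro iffI allI)
  assume "\<forall>\<alpha>. coeff f \<alpha> = 0"
  then show "f = 0" by (subst expand[of f]) simp
qed simp

lemma coeff_of_R: "r \<in> R \<Longrightarrow> coeff r \<alpha> = (if \<alpha> = 0 then r else 0)"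
  using coeff_scale[of r "mon 0" \<alpha>] coeff_mon[of 0 \<alpha>] by auto

lemma unit_exp_neq_0 [simp]: "unit_exp i \<noteq> 0"
  by (auto simp: unit_exp_def fun_eq_iff zero_fun_apply)

section \<open>The endomorphisms\<close>

text \<open>In the expansion of \<open>s x\<^sub>i + d\<close> the coefficient of \<open>x\<^sub>i\<close> is \<open>s\<close>, so the equation determines \<open>s\<close>.  The
  homomorphism laws below are instances: compute \<open>x\<^sub>i (r + s)\<close> and \<open>x\<^sub>i (r s)\<close> and read off that coefficient.\<close>

lemma sigma_eqI:
  assumes "i < n" "s \<in> R" "d \<in> R" "x i * r = s * x i + d"
  shows "\<sigma> i r = s"
proof -
  have lead: "coeff (s' * x i + d') (unit_exp i) = s'" if "s' \<in> R" "d' \<in> R" for s' d'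
    using that coeff_mon[of "unit_exp i" "unit_exp i"] assms(1) by (simp add: coeff_of_R)
  show ?thesis unfolding pbw_sigma_def
    using assms lead by (intro the_equality) metis+
qed

lemma sigma_ex:
  assumes "i < n" "r \<in> R"
  shows "\<exists>s\<in>R. \<exists>d\<in>R. x i * r = s * x i + d"
proof (cases "r = 0")
  case False
  then obtain c where "c \<in> R" "x i * r - c * x i \<in> R"
    using skew_pbw assms unfolding skew_pbw_extension_def by blast
  then show ?thesis by (metis add.commute diff_add_cancel)
next
  case True
  then show ?thesis using R_0 by (intro bexI[of _ 0]) auto
qed

lemma sigma:
  assumes "i < n" "r \<in> R"
  shows sigma_R [simp]: "\<sigma> i r \<in> R"
    and sigma_commute: "\<exists>d\<in>R. x i * r = \<sigma> i r * x i + d"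
  using sigma_ex[OF assms] sigma_eqI[OF assms(1)] by metis+

lemma sigma_add: 
  assumes "i < n" "r \<in> R" "s \<in> R"
  shows "\<sigma> i (r + s) = \<sigma> i r + \<sigma> i s"
proof -
  obtain d e where d: "d \<in> R" "x i * r = \<sigma> i r * x i + d" and e: "e \<in> R" "x i * s = \<sigma> i s * x i + e"
    using sigma_commute assms by metis
  then have "x i * (r + s) = (\<sigma> i r + \<sigma> i s) * x i + (d + e)"
    by (simp add: algebra_simps)
  with d e assms show ?thesis by (intro sigma_eqI) auto
qed

lemma sigma_mult: 
  assumes "i < n" "r \<in> R" "s \<in> R"
  shows "\<sigma> i (r * s) = \<sigma> i r * \<sigma> i s"
proof -
  obtain d e where d: "d \<in> R" "x i * r = \<sigma> i r * x i + d" and e: "e \<in> R" "x i * s = \<sigma> i s * x i + e"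
    using sigma_commute assms by metis
  have "x i * (r * s) = (x i * r) * s" by (simp add: mult.assoc)
  also have "\<dots> = \<sigma> i r * (x i * s) + d * s" by (simp add: d algebra_simps)
  also have "\<dots> = (\<sigma> i r * \<sigma> i s) * x i + (\<sigma> i r * e + d * s)" by (simp add: e algebra_simps)
  finally show ?thesis using d e assms by (intro sigma_eqI) auto
qed

lemma sigma_0: "i < n \<Longrightarrow> \<sigma> i 0 = 0"
  by (rule sigma_eqI[of _ _ 0]) auto

lemma sigma_1: "i < n \<Longrightarrow> \<sigma> i 1 = 1"
  by (rule sigma_eqI[of _ _ 0]) auto

lemma sigma_pow_R [simp]:
  assumes "\<alpha> \<in> E" "r \<in> R" shows "\<sigma>pow \<alpha> r \<in> R"
  using assms by (induction rule: exponents_induct) (auto simp: pbw_sigma_pow_unit_exp_add)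

lemma sigma_pow_add:
  assumes "\<alpha> \<in> E" "r \<in> R" "s \<in> R" shows "\<sigma>pow \<alpha> (r + s) = \<sigma>pow \<alpha> r + \<sigma>pow \<alpha> s"
  using assms by (induction rule: exponents_induct) (auto simp: pbw_sigma_pow_unit_exp_add sigma_add)

lemma sigma_pow_mult:
  assumes "\<alpha> \<in> E" "r \<in> R" "s \<in> R" shows "\<sigma>pow \<alpha> (r * s) = \<sigma>pow \<alpha> r * \<sigma>pow \<alpha> s"
  using assms by (induction rule: exponents_induct) (auto simp: pbw_sigma_pow_unit_exp_add sigma_mult)

lemma sigma_pow_0: "\<alpha> \<in> E \<Longrightarrow> \<sigma>pow \<alpha> 0 = 0"
  by (induction rule: exponents_induct) (auto simp: pbw_sigma_pow_unit_exp_add sigma_0)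

lemma sigma_pow_sum:
  assumes "\<alpha> \<in> E" "\<And>i. i \<in> I \<Longrightarrow> f i \<in> R"
  shows "\<sigma>pow \<alpha> (\<Sum>i\<in>I. f i) = (\<Sum>i\<in>I. \<sigma>pow \<alpha> (f i))"
  using assms(2)
  by (induction I rule: infinite_finite_induct)
     (auto simp: sigma_pow_0[OF assms(1)] sigma_pow_add[OF assms(1)] R_sum)

section \<open>The degree filtration\<close>

text \<open>The bound is strict so that \<open>deg_below 0 = {0}\<close> covers the case of a vanishing error term.\<close>

definition deg_below :: "nat \<Rightarrow> 'a set" where
  "deg_below d = {f. \<forall>\<alpha>. coeff f \<alpha> \<noteq> 0 \<longrightarrow> deg \<alpha> < d}"

lemma deg_belowD: "f \<in> deg_below d \<Longrightarrow> coeff f \<alpha> \<noteq> 0 \<Longrightarrow> deg \<alpha> < d"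
  by (simp add: deg_below_def)

lemma deg_below_coeff_0: "f \<in> deg_below d \<Longrightarrow> d \<le> deg \<alpha> \<Longrightarrow> coeff f \<alpha> = 0"
  by (meson deg_belowD not_less)

lemma deg_belowI: "(\<And>\<alpha>. d \<le> deg \<alpha> \<Longrightarrow> coeff f \<alpha> = 0) \<Longrightarrow> f \<in> deg_below d"
  unfolding deg_below_def by (blast intro: ccontr leI)

lemma deg_below_mono: "f \<in> deg_below d \<Longrightarrow> d \<le> e \<Longrightarrow> f \<in> deg_below e"
  by (rule deg_belowI, rule deg_below_coeff_0[of f d]) auto

lemma deg_below_0 [simp]: "0 \<in> deg_below d"
  by (simp add: deg_below_def)

lemma deg_below_add: "f \<in> deg_below d \<Longrightarrow> g \<in> deg_below d \<Longrightarrow> f + g \<in> deg_below d"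
  by (intro deg_belowI) (simp add: deg_below_coeff_0)

lemma deg_below_scale: "r \<in> R \<Longrightarrow> f \<in> deg_below d \<Longrightarrow> r * f \<in> deg_below d"
  by (intro deg_belowI) (simp add: deg_below_coeff_0)

lemma deg_below_sum: "(\<And>i. i \<in> I \<Longrightarrow> f i \<in> deg_below d) \<Longrightarrow> sum f I \<in> deg_below d"
  by (induction I rule: infinite_finite_induct) (auto intro: deg_below_add)

lemma deg_below_mon: "\<alpha> \<in> E \<Longrightarrow> deg \<alpha> < d \<Longrightarrow> mon \<alpha> \<in> deg_below d"
  by (simp add: deg_below_def coeff_mon)

lemma deg_below_of_R: "r \<in> R \<Longrightarrow> r \<in> deg_below (Suc d)"
  by (simp add: deg_below_def coeff_of_R)

lemma deg_below_iff_pbw_deg: "p \<in> deg_below d \<longleftrightarrow> p = 0 \<or> pbw_deg R n x p < d"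
proof (cases "p = 0")
  case False
  then have "{\<alpha>. coeff p \<alpha> \<noteq> 0} \<noteq> {}" using eq_0_iff_coeff[of p] by blast
  with False show ?thesis
    by (auto simp: pbw_deg_def pbw_support_def deg_below_def)
qed simp

lemma affine_forms_deg_below: "a \<in> affine_forms R n x \<Longrightarrow> a \<in> deg_below 2"
proof -
  have "x k \<in> deg_below 2" if "k < n" for k
    using deg_below_mon[of "unit_exp k" 2] that by simp
  then show "a \<in> affine_forms R n x \<Longrightarrow> a \<in> deg_below 2"
    unfolding affine_forms_def numeral_2_eq_2
    using deg_below_of_R[of _ 1] by (auto intro!: deg_below_add deg_below_sum deg_below_scale)
qed

text \<open>The degree bound on monomials is a hypothesis because this lemma serves inside the induction that
  proves it, where it is available only in degrees below \<open>d\<close>.\<close>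

lemma x_mult_deg_below_if_mon:
  assumes "i < n" and mon: "\<And>\<beta>. \<beta> \<in> E \<Longrightarrow> deg \<beta> < d \<Longrightarrow> x i * mon \<beta> \<in> deg_below (deg \<beta> + 2)"
    and f: "f \<in> deg_below d"
  shows "x i * f \<in> deg_below (Suc d)"
proof -
  have term_in: "x i * (coeff f \<beta> * mon \<beta>) \<in> deg_below (Suc d)" if "coeff f \<beta> \<noteq> 0" for \<beta>
  proof -
    have \<beta>: "\<beta> \<in> E" "deg \<beta> < d" using that f by (auto dest: coeff_E deg_belowD)
    obtain e where e: "e \<in> R" "x i * coeff f \<beta> = \<sigma> i (coeff f \<beta>) * x i + e"
      using sigma_commute assms(1) coeff_R by blast
    have "x i * (coeff f \<beta> * mon \<beta>) = (x i * coeff f \<beta>) * mon \<beta>"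
      by (simp add: mult.assoc)
    also have "\<dots> = \<sigma> i (coeff f \<beta>) * (x i * mon \<beta>) + e * mon \<beta>"
      by (simp add: e algebra_simps)
    finally show ?thesis
      using e \<beta> assms(1) deg_below_mono[OF mon[OF \<beta>], of "Suc d"]
      by (auto intro!: deg_below_add deg_below_scale deg_below_mon)
  qed
  have "x i * f = (\<Sum>\<beta> | coeff f \<beta> \<noteq> 0. x i * (coeff f \<beta> * mon \<beta>))"
    by (subst expand[of f]) (simp add: sum_distrib_left)
  also have "\<dots> \<in> deg_below (Suc d)"
    using term_in by (intro deg_below_sum) simp
  finally show ?thesis .
qed

definition R_units :: "'a set" where
  "R_units = {u \<in> R. \<exists>v\<in>R. u * v = 1 \<and> v * u = 1}"

lemma R_units_R [simp]: "u \<in> R_units \<Longrightarrow> u \<in> R"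
  by (simp add: R_units_def)

lemma R_unitsI: "u \<in> R \<Longrightarrow> v \<in> R \<Longrightarrow> u * v = 1 \<Longrightarrow> v * u = 1 \<Longrightarrow> u \<in> R_units"
  unfolding R_units_def by blast

lemma R_units_1 [simp]: "1 \<in> R_units"
  by (rule R_unitsI[of _ 1]) simp_all

lemma R_units_mult: 
  assumes "u \<in> R_units" "u' \<in> R_units" shows "u * u' \<in> R_units"
proof -
  obtain v v' where v: "v \<in> R" "u * v = 1" "v * u = 1" and v': "v' \<in> R" "u' * v' = 1" "v' * u' = 1"
    using assms unfolding R_units_def by blast
  have "(u * u') * (v' * v) = u * (u' * v') * v" "(v' * v) * (u * u') = v' * (v * u) * u'"
    by (simp_all add: mult.assoc)
  with v v' have "(u * u') * (v' * v) = 1" "(v' * v) * (u * u') = 1" by simp_all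
  with v v' assms show ?thesis by (intro R_unitsI[of _ "v' * v"]) simp_all
qed

lemma sigma_R_units: 
  assumes "i < n" "u \<in> R_units" shows "\<sigma> i u \<in> R_units"
proof -
  obtain v where v: "v \<in> R" "u * v = 1" "v * u = 1" and u: "u \<in> R"
    using assms unfolding R_units_def by blast
  then have "\<sigma> i u * \<sigma> i v = 1" "\<sigma> i v * \<sigma> i u = 1"
    using assms(1) by (simp_all flip: sigma_mult add: sigma_1)
  with assms v u show ?thesis by (intro R_unitsI[of _ "\<sigma> i v"]) simp_all
qed

lemma R_units_cancel_right: "u \<in> R_units \<Longrightarrow> a * u = 0 \<Longrightarrow> a = 0"
proof -
  assume "u \<in> R_units" and au: "a * u = 0"
  then obtain v where "u * v = 1" unfolding R_units_def by blast
  then have "a = (a * u) * v" by (simp add: mult.assoc)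
  with au show ?thesis by simp
qed

end

section \<open>Leading terms of products\<close>

locale bijective_skew_pbw = skew_pbw +
  assumes bij_sigma: "i < n \<Longrightarrow> bij_betw (\<sigma> i) R R"
    and commutation_coeff_unit: "i < j \<Longrightarrow> j < n \<Longrightarrow>
      \<exists>d\<in>R. pbw_commutation_coeff R n x i j * d = 1 \<and> d * pbw_commutation_coeff R n x i j = 1"
begin

lemma bij_sigma_pow:
  assumes "\<alpha> \<in> E" shows "bij_betw (\<sigma>pow \<alpha>) R R"
  using assms
proof (induction rule: exponents_induct)
  case zero
  have "\<sigma>pow 0 = id" by (simp add: fun_eq_iff)
  then show ?case by (simp only: bij_betw_id)
next
  case (add i \<alpha>)
  then have "\<sigma>pow (unit_exp i + \<alpha>) = \<sigma> i \<circ> \<sigma>pow \<alpha>"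
    by (simp add: fun_eq_iff pbw_sigma_pow_unit_exp_add)
  with add bij_sigma bij_betw_trans show ?case by metis
qed

text \<open>The coefficient \<open>c\<close> is determined as that of the basis monomial \<open>x\<^sub>i x\<^sub>j\<close>, to which affine forms do not
  contribute; hence it is the commutation coefficient that bijectivity makes invertible.\<close>

lemma commute_variables:
  assumes "i < j" "j < n"
  obtains c a where "c \<in> R_units" "a \<in> affine_forms R n x" "x j * x i = c * x i * x j + a"
proof -
  let ?P = "\<lambda>c. c \<in> R - {0} \<and> x j * x i - c * x i * x j \<in> affine_forms R n x"
  have i: "i < n" using assms by simp
  have xx: "x i * x j = mon (unit_exp i + unit_exp j)"
    using pbw_mon_unit_exp_add[of i n "unit_exp j" x] assms i
    by (auto simp: unit_exp_def[of j, THEN fun_cong])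
  have "coeff (x j * x i) (unit_exp i + unit_exp j) = c" if "?P c" for c
  proof -
    have c: "c \<in> R" using that by simp
    have "coeff (x j * x i - c * x i * x j) (unit_exp i + unit_exp j) = 0"
      using that assms i by (intro deg_below_coeff_0[OF affine_forms_deg_below]) auto
    then show ?thesis
      using c assms i by (simp add: mult.assoc xx coeff_mon)
  qed
  moreover have "\<exists>c. ?P c"
    using skew_pbw assms i unfolding skew_pbw_extension_def by blast
  ultimately have "\<exists>!c. ?P c" by metis
  then have "?P (pbw_commutation_coeff R n x i j)"
    unfolding pbw_commutation_coeff_def by (rule theI')
  moreover from this have "pbw_commutation_coeff R n x i j \<in> R_units"
    using commutation_coeff_unit[OF assms] R_unitsI by blast
  ultimately show thesis using that by (metis add.commute diff_add_cancel)
qed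

text \<open>Straightening \<open>x\<^sub>i x\<^sup>\<alpha>\<close> moves \<open>x\<^sub>i\<close> past the smallest variable of \<open>\<alpha>\<close>; the errors made on the
  way have smaller degree, so strong induction on the degree controls them.  Only commutations of
  \<open>x\<^sub>i\<close> with variables of smaller index occur, and their coefficients are units, hence the leading
  coefficient is a unit.\<close>

lemma x_mult_mon:
  assumes "i < n" "\<alpha> \<in> E"
  shows "\<exists>u\<in>R_units. x i * mon \<alpha> - u * mon (unit_exp i + \<alpha>) \<in> deg_below (Suc (deg \<alpha>))"
  using assms
proof (induction "deg \<alpha>" arbitrary: i \<alpha> rule: less_induct)
  case less
  have mon_in: "x l * mon \<beta> \<in> deg_below (deg \<beta> + 2)" if \<beta>: "l < n" "\<beta> \<in> E" "deg \<beta> < deg \<alpha>" for l \<beta>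
  proof -
    obtain u where u: "u \<in> R_units" "x l * mon \<beta> - u * mon (unit_exp l + \<beta>) \<in> deg_below (Suc (deg \<beta>))"
      using less.hyps[OF \<beta>(3,1,2)] by blast
    \<comment> \<open>one more degree accommodates the leading term itself\<close>
    have "(x l * mon \<beta> - u * mon (unit_exp l + \<beta>)) + u * mon (unit_exp l + \<beta>) \<in> deg_below (deg \<beta> + 2)"
      using u that by (intro deg_below_add deg_below_scale deg_below_mon deg_below_mono[OF u(2)]) auto
    then show ?thesis by simp
  qed
  have mult_in: "x l * f \<in> deg_below (Suc (deg \<alpha>))" if "l < n" "f \<in> deg_below (deg \<alpha>)" for l f
    using that by (intro x_mult_deg_below_if_mon mon_in) auto
  \<comment> \<open>the product is already in standard order, and there is no error term\<close>
  have exact: ?case if "\<forall>j<i. \<alpha> j = 0"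
    using pbw_mon_unit_exp_add[OF less.prems(1) that, of x] by (intro bexI[of _ 1]) auto
  from less.prems(2) show ?case
  proof (cases rule: exponents_cases)
    case 1
    then show ?thesis by (intro exact) (simp add: zero_fun_apply)
  next
    case (2 k \<alpha>')
    show ?thesis
    proof (cases "i \<le> k")
      case True
      with 2 show ?thesis by (intro exact) (auto simp: unit_exp_def plus_fun_apply)
    next
      case False
      then obtain c a where c: "c \<in> R_units" and a: "a \<in> affine_forms R n x"
        and xx: "x i * x k = c * x k * x i + a"
        using commute_variables less.prems(1) by (metis not_le)
      have deg: "deg \<alpha> = Suc (deg \<alpha>')" using 2 by simp
      then obtain u where u: "u \<in> R_units"
        and q: "x i * mon \<alpha>' - u * mon (unit_exp i + \<alpha>') \<in> deg_below (deg \<alpha>)"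
        using less.hyps[of \<alpha>' i] 2 less.prems(1) by auto
      define q where "q = x i * mon \<alpha>' - u * mon (unit_exp i + \<alpha>')"
      obtain e where e: "e \<in> R" "x k * u = \<sigma> k u * x k + e"
        using sigma_commute 2 u R_units_R by metis
      \<comment> \<open>\<open>k\<close> is the smallest index in sight, so putting \<open>x\<^sub>k\<close> back in front causes no error\<close>
      have xk: "x k * mon (unit_exp i + \<alpha>') = mon (unit_exp i + \<alpha>)"
        using pbw_mon_unit_exp_add[of k n "unit_exp i + \<alpha>'" x] 2 False
        by (simp add: unit_exp_def plus_fun_apply add.left_commute)
      have "x i * mon \<alpha> = (x i * x k) * mon \<alpha>'"
        using 2 pbw_mon_unit_exp_add[of k n \<alpha>' x] by (simp add: mult.assoc)
      also have "\<dots> = c * (x k * (x i * mon \<alpha>')) + a * mon \<alpha>'"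
        by (simp add: xx algebra_simps)
      also have "x i * mon \<alpha>' = u * mon (unit_exp i + \<alpha>') + q"
        by (simp add: q_def)
      also have "x k * \<dots> = (x k * u) * mon (unit_exp i + \<alpha>') + x k * q"
        by (simp add: algebra_simps)
      also have "\<dots> = \<sigma> k u * mon (unit_exp i + \<alpha>) + e * mon (unit_exp i + \<alpha>') + x k * q"
        unfolding e(2) by (simp add: distrib_right mult.assoc xk)
      finally have eq: "x i * mon \<alpha> - (c * \<sigma> k u) * mon (unit_exp i + \<alpha>)
          = c * (e * mon (unit_exp i + \<alpha>') + x k * q) + a * mon \<alpha>'"
        by (simp add: algebra_simps)
      have "a * mon \<alpha>' \<in> deg_below (Suc (deg \<alpha>))"
      proof -
        obtain r s where rs: "r \<in> R" "\<forall>l<n. s l \<in> R" and a_eq: "a = r + (\<Sum>l<n. s l * x l)"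
          using a unfolding affine_forms_def by blast
        have "s l * (x l * mon \<alpha>') \<in> deg_below (Suc (deg \<alpha>))" if "l < n" for l
        proof (rule deg_below_scale)
          show "x l * mon \<alpha>' \<in> deg_below (Suc (deg \<alpha>))"
            using that deg 2 by (intro mult_in deg_below_mon) simp_all
        qed (use rs that in simp)
        moreover have "r * mon \<alpha>' \<in> deg_below (Suc (deg \<alpha>))"
          using rs deg 2 by (intro deg_below_scale deg_below_mon) simp_all
        moreover have "a * mon \<alpha>' = r * mon \<alpha>' + (\<Sum>l<n. s l * (x l * mon \<alpha>'))"
          by (simp add: a_eq distrib_right sum_distrib_right mult.assoc)
        ultimately show ?thesis by (auto intro!: deg_below_add deg_below_sum)
      qed
      moreover have "e * mon (unit_exp i + \<alpha>') \<in> deg_below (Suc (deg \<alpha>))"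
        using deg 2 less.prems(1) e by (intro deg_below_scale deg_below_mon) auto
      moreover have "x k * q \<in> deg_below (Suc (deg \<alpha>))"
        using 2 q by (intro mult_in) (simp_all add: q_def)
      ultimately have "x i * mon \<alpha> - (c * \<sigma> k u) * mon (unit_exp i + \<alpha>) \<in> deg_below (Suc (deg \<alpha>))"
        unfolding eq using c by (simp add: deg_below_add deg_below_scale)
      moreover have "c * \<sigma> k u \<in> R_units"
        using c u 2 by (intro R_units_mult sigma_R_units)
      ultimately show ?thesis by blast
    qed
  qed
qed

lemma x_mult_deg_below:
  assumes "i < n" "f \<in> deg_below d" shows "x i * f \<in> deg_below (Suc d)"
proof (rule x_mult_deg_below_if_mon[OF assms(1) _ assms(2)])
  fix \<beta> assume \<beta>: "\<beta> \<in> E"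
  obtain u where u: "u \<in> R_units" "x i * mon \<beta> - u * mon (unit_exp i + \<beta>) \<in> deg_below (Suc (deg \<beta>))"
    using x_mult_mon assms(1) \<beta> by blast
  have "(x i * mon \<beta> - u * mon (unit_exp i + \<beta>)) + u * mon (unit_exp i + \<beta>) \<in> deg_below (deg \<beta> + 2)"
    using u \<beta> assms(1) by (intro deg_below_add deg_below_scale deg_below_mon deg_below_mono[OF u(2)]) auto
  then show "x i * mon \<beta> \<in> deg_below (deg \<beta> + 2)" by simp
qed

lemma mon_mult_deg_below:
  assumes "\<alpha> \<in> E" "f \<in> deg_below d" shows "mon \<alpha> * f \<in> deg_below (deg \<alpha> + d)"
  using assms(1)
proof (induction rule: exponents_induct)
  case (add i \<alpha>)
  with x_mult_deg_below[OF add(1) add(4)] show ?case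
    by (simp add: pbw_mon_unit_exp_add mult.assoc)
qed (simp add: assms(2))

text \<open>The bounds are strict, so the degree of the right factor is at most \<open>e\<close>.\<close>

lemma mult_deg_below:
  assumes f: "f \<in> deg_below d" and g: "g \<in> deg_below (Suc e)"
  shows "f * g \<in> deg_below (d + e)"
proof -
  have "f * g = (\<Sum>\<alpha> | coeff f \<alpha> \<noteq> 0. coeff f \<alpha> * (mon \<alpha> * g))"
    by (subst expand[of f]) (simp add: sum_distrib_right mult.assoc)
  also have "\<dots> \<in> deg_below (d + e)"
  proof (rule deg_below_sum, rule deg_below_scale)
    fix \<alpha> assume "\<alpha> \<in> {\<alpha>. coeff f \<alpha> \<noteq> 0}"
    then have "\<alpha> \<in> E" "deg \<alpha> < d" using f by (auto dest: coeff_E deg_belowD)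
    then show "mon \<alpha> * g \<in> deg_below (d + e)"
      by (intro deg_below_mono[OF mon_mult_deg_below[OF _ g]]) auto
  qed simp
  finally show ?thesis .
qed

lemma mon_mult_mon_unit:
  assumes "\<alpha> \<in> E" "\<beta> \<in> E"
  shows "\<exists>u\<in>R_units. mon \<alpha> * mon \<beta> - u * mon (\<alpha> + \<beta>) \<in> deg_below (deg \<alpha> + deg \<beta>)"
  using assms(1)
proof (induction rule: exponents_induct)
  case zero
  show ?case by (intro bexI[of _ 1]) auto
next
  case (add i \<alpha>)
  then obtain u where u: "u \<in> R_units" 
    and q: "mon \<alpha> * mon \<beta> - u * mon (\<alpha> + \<beta>) \<in> deg_below (deg \<alpha> + deg \<beta>)" by blast
  obtain v where v: "v \<in> R_units" 
    and p: "x i * mon (\<alpha> + \<beta>) - v * mon (unit_exp i + (\<alpha> + \<beta>)) \<in> deg_below (Suc (deg (\<alpha> + \<beta>)))"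
    using x_mult_mon[of i "\<alpha> + \<beta>"] add assms(2) by auto
  define q where "q = mon \<alpha> * mon \<beta> - u * mon (\<alpha> + \<beta>)"
  define p where "p = x i * mon (\<alpha> + \<beta>) - v * mon (unit_exp i + (\<alpha> + \<beta>))"
  obtain e where e: "e \<in> R" "x i * u = \<sigma> i u * x i + e"
    using sigma_commute add u R_units_R by metis
  have "mon (unit_exp i + \<alpha>) * mon \<beta> = x i * (mon \<alpha> * mon \<beta>)"
    using add by (simp add: pbw_mon_unit_exp_add mult.assoc)
  also have "mon \<alpha> * mon \<beta> = u * mon (\<alpha> + \<beta>) + q" by (simp add: q_def)
  also have "x i * \<dots> = (x i * u) * mon (\<alpha> + \<beta>) + x i * q"
    by (simp add: algebra_simps)
  also have "\<dots> = \<sigma> i u * (x i * mon (\<alpha> + \<beta>)) + e * mon (\<alpha> + \<beta>) + x i * q"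
    unfolding e(2) by (simp add: distrib_right mult.assoc)
  also have "x i * mon (\<alpha> + \<beta>) = v * mon (unit_exp i + (\<alpha> + \<beta>)) + p" by (simp add: p_def)
  finally have "mon (unit_exp i + \<alpha>) * mon \<beta> - (\<sigma> i u * v) * mon (unit_exp i + \<alpha> + \<beta>)
      = \<sigma> i u * p + e * mon (\<alpha> + \<beta>) + x i * q"
    by (simp add: algebra_simps)
  also have "\<dots> \<in> deg_below (deg (unit_exp i + \<alpha>) + deg \<beta>)"
    using p q add e u assms(2) x_mult_deg_below[of i q "deg \<alpha> + deg \<beta>"]
    by (simp add: deg_below_add deg_below_scale deg_below_mon flip: q_def p_def)
  finally show ?case
    using R_units_mult[OF sigma_R_units[OF add(1) u] v] by blast
qed

lemma pbw_c:
  assumes "\<alpha> \<in> E" "\<beta> \<in> E"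
  shows pbw_c_unit [simp]: "cc \<alpha> \<beta> \<in> R_units"
    and mon_mult_mon: "mon \<alpha> * mon \<beta> - cc \<alpha> \<beta> * mon (\<alpha> + \<beta>) \<in> deg_below (deg \<alpha> + deg \<beta>)"
proof -
  let ?P = "\<lambda>c. c \<in> R \<and> (\<exists>p. mon \<alpha> * mon \<beta> = c * mon (\<alpha> + \<beta>) + p \<and> 
          (p = 0 \<or> pbw_deg R n x p < deg (\<alpha> + \<beta>)))"
  have coeff_P: "coeff (mon \<alpha> * mon \<beta>) (\<alpha> + \<beta>) = c" if P: "?P c" for c
  proof -
    obtain p where p: "mon \<alpha> * mon \<beta> = c * mon (\<alpha> + \<beta>) + p" "p \<in> deg_below (deg (\<alpha> + \<beta>))"
      using P unfolding deg_below_iff_pbw_deg by blast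
    show ?thesis
      using P assms deg_below_coeff_0[OF p(2)] unfolding p(1) by (simp add: coeff_mon)
  qed
  obtain u where u: "u \<in> R_units" "mon \<alpha> * mon \<beta> - u * mon (\<alpha> + \<beta>) \<in> deg_below (deg \<alpha> + deg \<beta>)"
    using mon_mult_mon_unit assms by blast
  have "?P u" 
    using u by (auto simp: deg_below_iff_pbw_deg intro!: exI[of _ "mon \<alpha> * mon \<beta> - u * mon (\<alpha> + \<beta>)"])
  then have "cc \<alpha> \<beta> = u"
    unfolding pbw_c_def using coeff_P by (intro the_equality) metis+
  with u show "cc \<alpha> \<beta> \<in> R_units" 
    "mon \<alpha> * mon \<beta> - cc \<alpha> \<beta> * mon (\<alpha> + \<beta>) \<in> deg_below (deg \<alpha> + deg \<beta>)" by auto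
qed

lemma pbw_c_R [simp]: "\<alpha> \<in> E \<Longrightarrow> \<beta> \<in> E \<Longrightarrow> cc \<alpha> \<beta> \<in> R"
  by simp

lemma mon_mult_R:
  assumes "\<alpha> \<in> E" "r \<in> R"
  shows "mon \<alpha> * r - \<sigma>pow \<alpha> r * mon \<alpha> \<in> deg_below (deg \<alpha>)"
  using assms(1)
proof (induction rule: exponents_induct)
  case (add i \<alpha>)
  define q where "q = mon \<alpha> * r - \<sigma>pow \<alpha> r * mon \<alpha>"
  have s: "\<sigma>pow \<alpha> r \<in> R" using add assms by simp
  then obtain e where e: "e \<in> R" "x i * \<sigma>pow \<alpha> r = \<sigma> i (\<sigma>pow \<alpha> r) * x i + e"
    using sigma_commute add by metis
  have m: "mon (unit_exp i + \<alpha>) = x i * mon \<alpha>" "\<sigma>pow (unit_exp i + \<alpha>) r = \<sigma> i (\<sigma>pow \<alpha> r)"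
    using add by (simp_all add: pbw_mon_unit_exp_add pbw_sigma_pow_unit_exp_add)
  have "x i * mon \<alpha> * r = x i * (\<sigma>pow \<alpha> r * mon \<alpha> + q)"
    by (simp add: q_def mult.assoc)
  also have "\<dots> = (x i * \<sigma>pow \<alpha> r) * mon \<alpha> + x i * q" by (simp add: algebra_simps)
  finally have "x i * mon \<alpha> * r - \<sigma> i (\<sigma>pow \<alpha> r) * (x i * mon \<alpha>) = e * mon \<alpha> + x i * q"
    unfolding e(2) by (simp add: algebra_simps)
  also have "\<dots> \<in> deg_below (Suc (deg \<alpha>))"
    using e add x_mult_deg_below[of i q "deg \<alpha>"]
    by (simp add: deg_below_add deg_below_scale deg_below_mon flip: q_def)
  finally show ?case using add(1) by (simp add: m)
qed simp

lemma mon_mult_term: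
  assumes "\<alpha> \<in> E" "\<beta> \<in> E" "r \<in> R"
  shows "mon \<alpha> * (r * mon \<beta>) - (\<sigma>pow \<alpha> r * cc \<alpha> \<beta>) * mon (\<alpha> + \<beta>) \<in> deg_below (deg \<alpha> + deg \<beta>)"
proof -
  have "mon \<alpha> * (r * mon \<beta>) - (\<sigma>pow \<alpha> r * cc \<alpha> \<beta>) * mon (\<alpha> + \<beta>)
      = (mon \<alpha> * r - \<sigma>pow \<alpha> r * mon \<alpha>) * mon \<beta>
        + \<sigma>pow \<alpha> r * (mon \<alpha> * mon \<beta> - cc \<alpha> \<beta> * mon (\<alpha> + \<beta>))"
    by (simp add: algebra_simps)
  moreover have "(mon \<alpha> * r - \<sigma>pow \<alpha> r * mon \<alpha>) * mon \<beta> \<in> deg_below (deg \<alpha> + deg \<beta>)"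
    using assms by (intro mult_deg_below mon_mult_R deg_below_mon) simp_all
  moreover have "\<sigma>pow \<alpha> r * (mon \<alpha> * mon \<beta> - cc \<alpha> \<beta> * mon (\<alpha> + \<beta>)) \<in> deg_below (deg \<alpha> + deg \<beta>)"
    using assms by (intro deg_below_scale mon_mult_mon) simp_all
  ultimately show ?thesis using deg_below_add by simp
qed

lemma coeff_mon_mult:
  assumes "\<alpha> \<in> E"
  shows "coeff (mon \<alpha> * f) \<gamma> = (\<Sum>\<beta> | coeff f \<beta> \<noteq> 0. coeff (mon \<alpha> * (coeff f \<beta> * mon \<beta>)) \<gamma>)"
proof -
  have "mon \<alpha> * f = (\<Sum>\<beta> | coeff f \<beta> \<noteq> 0. mon \<alpha> * (coeff f \<beta> * mon \<beta>))"
    by (subst expand[of f]) (simp add: sum_distrib_left)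
  then show ?thesis by simp
qed

lemma support_mon_mult:
  assumes "\<alpha> \<in> E" "coeff (mon \<alpha> * f) \<gamma> \<noteq> 0"
  obtains \<beta> where "coeff f \<beta> \<noteq> 0" "\<gamma> = \<alpha> + \<beta> \<or> deg \<gamma> < deg \<alpha> + deg \<beta>"
proof -
  have "\<exists>\<beta>. coeff f \<beta> \<noteq> 0 \<and> coeff (mon \<alpha> * (coeff f \<beta> * mon \<beta>)) \<gamma> \<noteq> 0"
  proof (rule ccontr)
    assume "\<not> ?thesis"
    then have "coeff (mon \<alpha> * f) \<gamma> = 0"
      by (subst coeff_mon_mult[OF assms(1), of f], intro sum.neutral) blast
    with assms(2) show False by contradiction
  qed
  then obtain \<beta> where \<beta>: "coeff f \<beta> \<noteq> 0" "coeff (mon \<alpha> * (coeff f \<beta> * mon \<beta>)) \<gamma> \<noteq> 0" by blast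
  have "\<beta> \<in> E" using \<beta> coeff_E by blast
  have "deg \<gamma> < deg \<alpha> + deg \<beta>" if "\<gamma> \<noteq> \<alpha> + \<beta>"
    using \<beta> that assms(1) \<open>\<beta> \<in> E\<close>
    by (intro deg_belowD[OF mon_mult_term[OF assms(1) \<open>\<beta> \<in> E\<close> coeff_R[of f \<beta>]]]) (simp add: coeff_mon)
  with \<beta> that show thesis by blast
qed

text \<open>Only the term of \<open>f\<close> at \<open>\<beta>\<close> reaches \<open>\<alpha> + \<beta>\<close>: by the degree bound on \<open>f\<close>, the error terms produced by
  all monomials of \<open>f\<close> have degree below \<open>|\<alpha> + \<beta>|\<close>.\<close>

lemma top_coeff_mon_mult:
  assumes "\<alpha> \<in> E" "\<beta> \<in> E" "f \<in> deg_below (Suc (deg \<beta>))"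
  shows "coeff (mon \<alpha> * f) (\<alpha> + \<beta>) = \<sigma>pow \<alpha> (coeff f \<beta>) * cc \<alpha> \<beta>"
proof -
  have "coeff (mon \<alpha> * (coeff f \<gamma> * mon \<gamma>)) (\<alpha> + \<beta>)
      = (if \<gamma> = \<beta> then \<sigma>pow \<alpha> (coeff f \<beta>) * cc \<alpha> \<beta> else 0)" if "coeff f \<gamma> \<noteq> 0" for \<gamma>
  proof -
    have \<gamma>: "\<gamma> \<in> E" "deg \<gamma> \<le> deg \<beta>" using that assms(3) by (auto dest: coeff_E deg_belowD)
    have "coeff (mon \<alpha> * (coeff f \<gamma> * mon \<gamma>) - (\<sigma>pow \<alpha> (coeff f \<gamma>) * cc \<alpha> \<gamma>) * mon (\<alpha> + \<gamma>)) (\<alpha> + \<beta>) = 0"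
      using \<gamma> assms by (intro deg_below_coeff_0[OF mon_mult_term]) auto
    then show ?thesis using \<gamma> assms by (auto simp: coeff_mon)
  qed
  then have "coeff (mon \<alpha> * f) (\<alpha> + \<beta>)
      = (\<Sum>\<gamma> | coeff f \<gamma> \<noteq> 0. if \<gamma> = \<beta> then \<sigma>pow \<alpha> (coeff f \<beta>) * cc \<alpha> \<beta> else 0)"
    by (subst coeff_mon_mult[OF assms(1), of f], intro sum.cong) auto
  then show ?thesis using assms(1) by (auto simp: sigma_pow_0)
qed

text \<open>Both sides are the leading coefficient of \<open>x\<^sup>\<delta> x\<^sup>\<gamma> (l x\<^sup>\<beta>)\<close>, bracketed in the two possible ways.\<close>

lemma cocycle:
  assumes "\<delta> \<in> E" "\<gamma> \<in> E" "\<beta> \<in> E" "l \<in> R"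
  shows "\<sigma>pow \<delta> (\<sigma>pow \<gamma> l * cc \<gamma> \<beta>) * cc \<delta> (\<gamma> + \<beta>) = cc \<delta> \<gamma> * \<sigma>pow (\<delta> + \<gamma>) l * cc (\<delta> + \<gamma>) \<beta>"
proof -
  let ?f = "l * mon \<beta>"
  define p where "p = mon \<delta> * mon \<gamma> - cc \<delta> \<gamma> * mon (\<delta> + \<gamma>)"
  have f: "?f \<in> deg_below (Suc (deg \<beta>))" 
    using assms by (intro deg_below_scale deg_below_mon) auto
  have lf: "coeff ?f \<beta> = l" using assms by (simp add: coeff_mon)
  have gf: "mon \<gamma> * ?f \<in> deg_below (Suc (deg (\<gamma> + \<beta>)))"
    using mon_mult_deg_below[OF assms(2) f] by simp
  have p: "p \<in> deg_below (deg \<delta> + deg \<gamma>)" using mon_mult_mon assms by (simp add: p_def)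
  have "coeff (mon \<delta> * (mon \<gamma> * ?f)) (\<delta> + (\<gamma> + \<beta>)) = \<sigma>pow \<delta> (\<sigma>pow \<gamma> l * cc \<gamma> \<beta>) * cc \<delta> (\<gamma> + \<beta>)"
    using assms f lf gf by (simp add: top_coeff_mon_mult)
  moreover have "coeff (mon \<delta> * (mon \<gamma> * ?f)) (\<delta> + \<gamma> + \<beta>) = cc \<delta> \<gamma> * (\<sigma>pow (\<delta> + \<gamma>) l * cc (\<delta> + \<gamma>) \<beta>)"
  proof -
    have "mon \<delta> * (mon \<gamma> * ?f) = cc \<delta> \<gamma> * (mon (\<delta> + \<gamma>) * ?f) + p * ?f"
      by (simp add: p_def algebra_simps)
    moreover have "coeff (p * ?f) (\<delta> + \<gamma> + \<beta>) = 0"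
      by (rule deg_below_coeff_0[OF mult_deg_below[OF p f]]) simp
    ultimately show ?thesis 
      using assms f lf by (simp add: top_coeff_mon_mult)
  qed
  ultimately show ?thesis by (simp add: add.assoc mult.assoc)
qed

text \<open>The order refines the degree, and the coefficient of \<open>x\<^bsup>\<alpha>+\<beta>\<^esup>\<close> is a unit, hence
  non-zero.  With this the compatibility of the order on vector monomials becomes invariance under
  shifts of exponents.\<close>

lemma pbw_lm_mon_mult:
  assumes ord: "pbw_monomial_order R n x ord" and "\<alpha> \<in> E" "\<beta> \<in> E"
  shows "pbw_lm R n x ord (mon \<alpha> * mon \<beta>) = \<alpha> + \<beta>"
proof -
  let ?f = "mon \<alpha> * mon \<beta>"
  have lin: "linear_order_on E ord" and deg: "\<And>\<alpha> \<beta>. \<alpha> \<in> E \<Longrightarrow> \<beta> \<in> E \<Longrightarrow> deg \<alpha> < deg \<beta> \<Longrightarrow> (\<alpha>, \<beta>) \<in> ord"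
    using ord unfolding pbw_monomial_order_def by blast+
  have f: "coeff (?f - cc \<alpha> \<beta> * mon (\<alpha> + \<beta>)) \<gamma> = coeff ?f \<gamma> - (if \<gamma> = \<alpha> + \<beta> then cc \<alpha> \<beta> else 0)" for \<gamma>
    using assms by (simp add: coeff_mon)
  have low: "?f - cc \<alpha> \<beta> * mon (\<alpha> + \<beta>) \<in> deg_below (deg (\<alpha> + \<beta>))"
    using mon_mult_mon assms by simp
  have "coeff ?f (\<alpha> + \<beta>) = cc \<alpha> \<beta>"
    using f[of "\<alpha> + \<beta>"] deg_below_coeff_0[OF low, of "\<alpha> + \<beta>"] by simp
  moreover have "cc \<alpha> \<beta> \<noteq> 0"
    using R_units_cancel_right[OF pbw_c_unit[OF assms(2,3)], of 1] by auto
  ultimately have top: "\<alpha> + \<beta> \<in> pbw_support R n x ?f"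
    by (simp add: pbw_support_def)
  have bound: "(\<gamma>, \<alpha> + \<beta>) \<in> ord" if "\<gamma> \<in> pbw_support R n x ?f" for \<gamma>
  proof (cases "\<gamma> = \<alpha> + \<beta>")
    case True
    then show ?thesis using lin assms 
      by (simp add: linear_order_on_def partial_order_on_def preorder_on_def refl_on_def)
  next
    case False
    then have "deg \<gamma> < deg (\<alpha> + \<beta>)" and "\<gamma> \<in> E"
      using that f[of \<gamma>] deg_belowD[OF low, of \<gamma>] coeff_E[of ?f \<gamma>] by (simp_all add: pbw_support_def)
    then show ?thesis using deg assms by simp
  qed
  have "antisym ord" using lin by (simp add: linear_order_on_def partial_order_on_def)
  then show ?thesis
    unfolding pbw_lm_def using top bound by (intro the_equality) (auto dest: antisymD)
qed

end

section \<open>Leading monomials of vectors\<close>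

lemma finite_linear_order_max:
  assumes "linear_order_on A ord" "finite S" "S \<noteq> {}" "S \<subseteq> A"
  shows "\<exists>X\<in>S. \<forall>Y\<in>S. (Y, X) \<in> ord"
  using assms(2-)
proof (induction S rule: finite_ne_induct)
  case (singleton X)
  then show ?case using assms(1) 
    by (simp add: linear_order_on_def partial_order_on_def preorder_on_def refl_on_def)
next
  case (insert X S)
  then obtain Z where Z: "Z \<in> S" "\<forall>Y\<in>S. (Y, Z) \<in> ord" by auto
  have XZ: "X \<in> A" "Z \<in> A" using insert Z by auto
  have rfl: "(X, X) \<in> ord" and tot: "(X, Z) \<in> ord \<or> (Z, X) \<in> ord" and tr: "trans ord"
    using assms(1) XZ unfolding linear_order_on_def partial_order_on_def preorder_on_def refl_on_def total_on_def
    by metis+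
  show ?case
  proof (cases "(X, Z) \<in> ord")
    case True
    with Z show ?thesis by blast
  next
    case False
    with tot Z tr have "\<forall>Y\<in>S. (Y, X) \<in> ord" by (meson transD)
    with rfl show ?thesis by blast
  qed
qed

lemma smult_sum_left: "(\<Sum>i\<in>I. c i) *s (v :: 'a::ring_1 ^ 'm) = (\<Sum>i\<in>I. c i *s v)"
  by (simp add: vec_eq_iff sum_distrib_right)

lemma smult_sum_right: "c *s (\<Sum>i\<in>I. v i :: 'a::ring_1 ^ 'm) = (\<Sum>i\<in>I. c *s v i)"
  by (simp add: vec_eq_iff sum_distrib_left)

definition shift :: "expo \<Rightarrow> expo \<times> 'm \<Rightarrow> expo \<times> 'm" where
  "shift \<alpha> X = (\<alpha> + fst X, snd X)"

lemma fst_shift [simp]: "fst (shift \<alpha> X) = \<alpha> + fst X"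
  and snd_shift [simp]: "snd (shift \<alpha> X) = snd X"
  by (simp_all add: shift_def)

lemma shift_shift: "shift \<alpha> (shift \<beta> X) = shift (\<alpha> + \<beta>) X"
  by (simp add: shift_def add.assoc)

text \<open>The order on vector monomials, with the leading monomials of products already evaluated.\<close>

locale pbw_module = bijective_skew_pbw R n x
  for R :: "'a::ring_1 set" and n x +
  fixes vord :: "(expo \<times> 'm::finite) rel"
  assumes linear: "linear_order_on (E \<times> UNIV) vord"
    and shift_vord: "(X, Y) \<in> vord \<Longrightarrow> \<gamma> \<in> E \<Longrightarrow> (shift \<gamma> X, shift \<gamma> Y) \<in> vord"
    and deg_vord: "fst X \<in> E \<Longrightarrow> fst Y \<in> E \<Longrightarrow> deg (fst X) < deg (fst Y) \<Longrightarrow> (X, Y) \<in> vord"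
begin

abbreviation "vc \<equiv> vec_coeff R n x"
abbreviation "lm \<equiv> vec_lm R n x vord"
abbreviation "lc \<equiv> vec_lc R n x vord"

definition below :: "expo \<times> 'm \<Rightarrow> (expo \<times> 'm) set" where
  "below X = {Y. (Y, X) \<in> vord \<and> Y \<noteq> X}"

definition atmost :: "expo \<times> 'm \<Rightarrow> (expo \<times> 'm) set" where
  "atmost X = {Y. (Y, X) \<in> vord}"

definition down_closed :: "(expo \<times> 'm) set \<Rightarrow> bool" where
  "down_closed D \<longleftrightarrow> (\<forall>X\<in>D. atmost X \<subseteq> D)"

lemma vord_refl: "fst X \<in> E \<Longrightarrow> (X, X) \<in> vord"
  using linear unfolding linear_order_on_def partial_order_on_def preorder_on_def refl_on_def
  by (metis UNIV_I mem_Times_iff)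

lemma vord_trans: "(X, Y) \<in> vord \<Longrightarrow> (Y, Z) \<in> vord \<Longrightarrow> (X, Z) \<in> vord"
  using linear by (auto simp: linear_order_on_def partial_order_on_def preorder_on_def dest: transD)

lemma vord_antisym: "(X, Y) \<in> vord \<Longrightarrow> (Y, X) \<in> vord \<Longrightarrow> X = Y"
  using linear by (auto simp: linear_order_on_def partial_order_on_def dest: antisymD)

lemma vord_E: "(X, Y) \<in> vord \<Longrightarrow> fst X \<in> E \<and> fst Y \<in> E"
  using linear 
  by (auto simp: linear_order_on_def partial_order_on_def preorder_on_def mem_Times_iff)

lemma vord_total: "fst X \<in> E \<Longrightarrow> fst Y \<in> E \<Longrightarrow> (X, Y) \<in> vord \<or> (Y, X) \<in> vord"
  using linear vord_refl[of X] unfolding linear_order_on_def total_on_def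
  by (metis UNIV_I mem_Times_iff)

lemma vord_deg: "(X, Y) \<in> vord \<Longrightarrow> deg (fst X) \<le> deg (fst Y)"
  using deg_vord[of Y X] vord_E[of X Y] vord_antisym[of X Y] by (metis linorder_not_less order_less_irrefl)

lemma below_atmost: "below X \<subseteq> atmost X"
  by (auto simp: below_def atmost_def)

lemma below_E: "Y \<in> below X \<Longrightarrow> fst Y \<in> E"
  using vord_E[of Y X] by (auto simp: below_def)

lemma below_iff_atmost: "Y \<in> below X \<longleftrightarrow> Y \<in> atmost X \<and> Y \<noteq> X"
  by (auto simp: below_def atmost_def)

lemma self_atmost: "fst X \<in> E \<Longrightarrow> X \<in> atmost X"
  by (simp add: atmost_def vord_refl)

lemma atmost_mono: "Y \<in> atmost X \<Longrightarrow> atmost Y \<subseteq> atmost X"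
  unfolding atmost_def by (blast intro: vord_trans)

lemma down_closed_atmost: "down_closed (atmost X)"
  using atmost_mono by (auto simp: down_closed_def)

lemma down_closed_below: "down_closed (below X)"
  unfolding down_closed_def below_def atmost_def by (blast intro: vord_trans dest: vord_antisym)

lemma below_if_deg: "fst X \<in> E \<Longrightarrow> fst Y \<in> E \<Longrightarrow> deg (fst X) < deg (fst Y) \<Longrightarrow> X \<in> below Y"
  using deg_vord by (auto simp: below_def)

lemma shift_below: "Y \<in> below X \<Longrightarrow> \<gamma> \<in> E \<Longrightarrow> shift \<gamma> Y \<in> below (shift \<gamma> X)"
  using shift_vord by (auto simp: below_def shift_def prod_eq_iff)

text \<open>Because degrees are compared first, only finitely many monomials lie below a given one.\<close>

lemma finite_atmost: "finite (atmost X)"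
proof (rule finite_subset)
  show "atmost X \<subseteq> {\<alpha> \<in> E. deg \<alpha> \<le> deg (fst X)} \<times> UNIV"
  proof
    fix Y assume "Y \<in> atmost X"
    then show "Y \<in> {\<alpha> \<in> E. deg \<alpha> \<le> deg (fst X)} \<times> UNIV"
      using vord_deg[of Y X] vord_E[of Y X] by (simp add: atmost_def mem_Times_iff)
  qed
qed (simp add: finite_bounded_exponents)

lemma vord_induct [case_names less]:
  assumes "\<And>X. (\<And>Y. Y \<in> below X \<Longrightarrow> P Y) \<Longrightarrow> P X"
  shows "P X"
proof (induction "card (atmost X)" arbitrary: X rule: less_induct)
  case less
  show ?case
  proof (rule assms)
    fix Y assume Y: "Y \<in> below X"
    then have "fst X \<in> E" using vord_E[of Y X] by (simp add: below_def)
    moreover have "X \<notin> atmost Y" using Y vord_antisym[of X Y] by (auto simp: below_def atmost_def)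
    ultimately have "atmost Y \<subset> atmost X" 
      using Y atmost_mono[of Y X] self_atmost[of X] below_atmost[of X] by blast
    then show "P Y" by (intro less psubset_card_mono finite_atmost)
  qed
qed

lemma vc_E: "vc f X \<noteq> 0 \<Longrightarrow> fst X \<in> E"
  by (auto simp: vec_coeff_def dest: coeff_E)

lemma vc_add [simp]: "vc (f + g) X = vc f X + vc g X"
  and vc_diff [simp]: "vc (f - g) X = vc f X - vc g X"
  and vc_0 [simp]: "vc 0 X = 0"
  by (simp_all add: vec_coeff_def)

lemma vc_sum [simp]: "vc (\<Sum>i\<in>I. f i) X = (\<Sum>i\<in>I. vc (f i) X)"
  by (simp add: vec_coeff_def)

lemma finite_vc: "finite {X. vc f X \<noteq> 0}"
proof (rule finite_subset)
  show "{X. vc f X \<noteq> 0} \<subseteq> (\<Union>i. {\<alpha>. coeff (f $ i) \<alpha> \<noteq> 0} \<times> {i})"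
    by (auto simp: vec_coeff_def)
qed simp

lemma vc_all_0: "(\<And>X. vc f X = 0) \<Longrightarrow> f = 0"
proof -
  assume 0: "\<And>X. vc f X = 0"
  have "f $ i = 0" for i
    using 0[of "(_, i)"] by (intro iffD2[OF eq_0_iff_coeff]) (simp add: vec_coeff_def)
  then show ?thesis by (simp add: vec_eq_iff)
qed

lemma lm_eqI: "vc f X \<noteq> 0 \<Longrightarrow> (\<And>Y. vc f Y \<noteq> 0 \<Longrightarrow> Y \<in> atmost X) \<Longrightarrow> lm f = X"
  unfolding vec_lm_def atmost_def using vord_antisym by (intro the_equality) blast+

lemma lm:
  assumes "f \<noteq> 0"
  shows lc_neq_0: "lc f \<noteq> 0" and vc_atmost_lm: "vc f Y \<noteq> 0 \<Longrightarrow> Y \<in> atmost (lm f)"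
proof -
  have "{X. vc f X \<noteq> 0} \<noteq> {}" using vc_all_0 assms by blast
  moreover have "{X. vc f X \<noteq> 0} \<subseteq> E \<times> UNIV"
    using vc_E[of f] by (blast intro: mem_Times_iff[THEN iffD2])
  ultimately obtain X where X: "vc f X \<noteq> 0" "\<And>Y. vc f Y \<noteq> 0 \<Longrightarrow> Y \<in> atmost X"
    using finite_linear_order_max[OF linear finite_vc] unfolding atmost_def by blast
  then have "lm f = X" by (rule lm_eqI)
  with X show "lc f \<noteq> 0" "vc f Y \<noteq> 0 \<Longrightarrow> Y \<in> atmost (lm f)" by (simp_all add: vec_lc_def)
qed

lemma lm_E: "f \<noteq> 0 \<Longrightarrow> fst (lm f) \<in> E"
  using lc_neq_0[of f] vc_E[of f "lm f"] by (simp add: vec_lc_def)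

lemma lc_R [simp]: "lc f \<in> R"
  by (simp add: vec_lc_def vec_coeff_def)

lemma vc_mult_atmost:
  assumes "g \<noteq> 0" "r \<in> R" "\<alpha> \<in> E" "vc ((r * mon \<alpha>) *s g) Y \<noteq> 0"
  shows "Y \<in> atmost (shift \<alpha> (lm g))"
proof -
  obtain \<gamma> i where Y: "Y = (\<gamma>, i)" by force
  have "r * coeff (mon \<alpha> * g $ i) \<gamma> \<noteq> 0" 
    using assms(2,4) by (simp add: Y vec_coeff_def mult.assoc)
  then have nz: "coeff (mon \<alpha> * g $ i) \<gamma> \<noteq> 0" by auto
  then obtain \<beta> where \<beta>: "coeff (g $ i) \<beta> \<noteq> 0" "\<gamma> = \<alpha> + \<beta> \<or> deg \<gamma> < deg \<alpha> + deg \<beta>"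
    using support_mon_mult[OF assms(3)] by metis
  have up: "((\<beta>, i), lm g) \<in> vord"
    using vc_atmost_lm[OF assms(1), of "(\<beta>, i)"] \<beta> by (simp add: vec_coeff_def atmost_def)
  from \<beta>(2) show ?thesis
  proof
    assume "\<gamma> = \<alpha> + \<beta>"
    then show ?thesis using shift_vord[OF up assms(3)] by (simp add: Y atmost_def shift_def)
  next
    assume "deg \<gamma> < deg \<alpha> + deg \<beta>"
    then have "deg \<gamma> < deg (fst (shift \<alpha> (lm g)))" using vord_deg[OF up] by simp
    moreover have "\<gamma> \<in> E" using nz by (rule coeff_E)
    ultimately show ?thesis
      using assms(1,3) lm_E deg_vord[of Y "shift \<alpha> (lm g)"] by (simp add: atmost_def Y)
  qed
qed

text \<open>The monomial order refines the degree, so all monomials of \<open>g\<close> have degree at most that of \<open>lm(g)\<close>, as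
  \<open>top_coeff_mon_mult\<close> demands.\<close>

lemma vc_mult_top:
  assumes "g \<noteq> 0" "r \<in> R" "\<alpha> \<in> E"
  shows "vc ((r * mon \<alpha>) *s g) (shift \<alpha> (lm g)) = r * \<sigma>pow \<alpha> (lc g) * cc \<alpha> (fst (lm g))"
proof -
  let ?h = "g $ snd (lm g)"
  have "?h \<in> deg_below (Suc (deg (fst (lm g))))"
    unfolding deg_below_def
  proof clarify
    fix \<beta> assume "coeff ?h \<beta> \<noteq> 0"
    then have "((\<beta>, snd (lm g)), lm g) \<in> vord"
      using vc_atmost_lm[OF assms(1), of "(\<beta>, snd (lm g))"] by (simp add: vec_coeff_def atmost_def)
    then show "deg \<beta> < Suc (deg (fst (lm g)))" using vord_deg by fastforce
  qed
  then have "coeff (mon \<alpha> * ?h) (\<alpha> + fst (lm g)) = \<sigma>pow \<alpha> (lc g) * cc \<alpha> (fst (lm g))"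
    using assms lm_E by (simp add: top_coeff_mon_mult vec_lc_def vec_coeff_def)
  then show ?thesis
    using assms by (simp add: vec_coeff_def mult.assoc)
qed

end

section \<open>Combinations with bounded leading monomials\<close>

locale pbw_generators = pbw_module R n x vord
  for R :: "'a::ring_1 set" and n x and vord :: "(expo \<times> 'm::finite) rel" +
  fixes G :: "('a ^ 'm) set"
  assumes finite_G: "finite G" and G_neq_0: "g \<in> G \<Longrightarrow> g \<noteq> 0"
begin

text \<open>The vectors that have a representation \<open>\<Sum> r x\<^sup>\<alpha> g\<close> all of whose heights \<open>x\<^sup>\<alpha> lm(g)\<close> lie in \<open>D\<close>.\<close>

inductive_set combinations :: "(expo \<times> 'm) set \<Rightarrow> ('a ^ 'm) set" for D where
  zero: "0 \<in> combinations D"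
| plus: "f \<in> combinations D \<Longrightarrow> g \<in> G \<Longrightarrow> r \<in> R \<Longrightarrow> \<alpha> \<in> E \<Longrightarrow> shift \<alpha> (lm g) \<in> D \<Longrightarrow>
    (r * mon \<alpha>) *s g + f \<in> combinations D"

lemma combinations_single:
  "g \<in> G \<Longrightarrow> r \<in> R \<Longrightarrow> \<alpha> \<in> E \<Longrightarrow> shift \<alpha> (lm g) \<in> D \<Longrightarrow> (r * mon \<alpha>) *s g \<in> combinations D"
  using combinations.plus[OF combinations.zero] by force

lemma combinations_add: "f \<in> combinations D \<Longrightarrow> h \<in> combinations D \<Longrightarrow> f + h \<in> combinations D"
  by (induction rule: combinations.induct) (auto simp: add.assoc intro: combinations.plus)

lemma combinations_sum: "(\<And>i. i \<in> I \<Longrightarrow> f i \<in> combinations D) \<Longrightarrow> sum f I \<in> combinations D"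
  by (induction I rule: infinite_finite_induct) (auto intro: combinations.zero combinations_add)

lemma combinations_scale: "f \<in> combinations D \<Longrightarrow> r \<in> R \<Longrightarrow> r *s f \<in> combinations D"
proof (induction rule: combinations.induct)
  case (plus f g s \<alpha>)
  have "r *s ((s * mon \<alpha>) *s g + f) = ((r * s) * mon \<alpha>) *s g + r *s f"
    by (simp add: vector_add_ldistrib vector_smult_assoc mult.assoc)
  with plus show ?case by (simp add: combinations.plus)
qed (simp add: combinations.zero)

lemma combinations_diff: "f \<in> combinations D \<Longrightarrow> h \<in> combinations D \<Longrightarrow> f - h \<in> combinations D"
  using combinations_add[of f D "(- 1) *s h"] combinations_scale[of h D "- 1"] 
  by (simp add: vector_sneg_minus1[symmetric])

lemma combinations_mono: "f \<in> combinations D \<Longrightarrow> D \<subseteq> D' \<Longrightarrow> f \<in> combinations D'"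
  by (induction rule: combinations.induct) (auto intro: combinations.intros)

lemma smult_expand: "p *s (g :: 'a ^ 'm) = (\<Sum>\<alpha> | coeff p \<alpha> \<noteq> 0. (coeff p \<alpha> * mon \<alpha>) *s g)"
  by (subst expand[of p]) (rule smult_sum_left)

text \<open>Error terms in products of monomials are absorbed by this lemma: a smaller degree already means a
  smaller height.\<close>

lemma combinations_deg_below:
  assumes "p \<in> deg_below d" "g \<in> G" "fst X \<in> E" "d + deg (fst (lm g)) \<le> deg (fst X)"
  shows "p *s g \<in> combinations (below X)"
  unfolding smult_expand[of p]
proof (rule combinations_sum)
  fix \<alpha> assume "\<alpha> \<in> {\<alpha>. coeff p \<alpha> \<noteq> 0}"
  then have "\<alpha> \<in> E" "deg \<alpha> < d" using assms(1) by (auto dest: coeff_E deg_belowD)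
  with assms show "(coeff p \<alpha> * mon \<alpha>) *s g \<in> combinations (below X)"
    by (intro combinations_single below_if_deg) (auto simp: lm_E G_neq_0)
qed

lemma combinations_support:
  assumes "f \<in> combinations D" "down_closed D" "vc f Y \<noteq> 0"
  shows "Y \<in> D"
  using assms(1,3)
proof (induction rule: combinations.induct)
  case (plus f g r \<alpha>)
  then consider "vc f Y \<noteq> 0" | "vc ((r * mon \<alpha>) *s g) Y \<noteq> 0" by fastforce
  then show ?case
  proof cases
    case 2
    then have "Y \<in> atmost (shift \<alpha> (lm g))" using plus G_neq_0 vc_mult_atmost by blast
    then show ?thesis using plus assms(2) by (auto simp: down_closed_def)
  qed (use plus in blast)
qed simp

lemma combinations_below_vc_0: "f \<in> combinations (below X) \<Longrightarrow> vc f X = 0"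
  using combinations_support[OF _ down_closed_below, of f X X] by (auto simp: below_def)

lemma mon_smult_combinations:
  assumes "f \<in> combinations (below X)" "\<delta> \<in> E" "fst X \<in> E"
  shows "mon \<delta> *s f \<in> combinations (below (shift \<delta> X))"
  using assms(1)
proof (induction rule: combinations.induct)
  case (plus f g r \<alpha>)
  define u where "u = \<sigma>pow \<delta> r * cc \<delta> \<alpha>"
  define p where "p = mon \<delta> * (r * mon \<alpha>) - u * mon (\<delta> + \<alpha>)"
  have p: "p \<in> deg_below (deg \<delta> + deg \<alpha>)"
    unfolding p_def u_def using plus assms by (intro mon_mult_term) 
  have u: "u \<in> R" using plus assms by (simp add: u_def)
  have "deg (fst (shift \<alpha> (lm g))) \<le> deg (fst X)"
    using plus vord_deg[of "shift \<alpha> (lm g)" X] by (simp add: below_def)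
  then have "p *s g \<in> combinations (below (shift \<delta> X))"
    using plus assms by (intro combinations_deg_below[OF p]) auto
  moreover have "(u * mon (\<delta> + \<alpha>)) *s g \<in> combinations (below (shift \<delta> X))"
    using plus assms u shift_below[of "shift \<alpha> (lm g)" X \<delta>]
    by (intro combinations_single) (auto simp: shift_shift)
  moreover have "mon \<delta> *s ((r * mon \<alpha>) *s g + f) = (u * mon (\<delta> + \<alpha>)) *s g + p *s g + mon \<delta> *s f"
    by (simp add: vector_add_ldistrib vector_smult_assoc p_def vector_sadd_rdistrib[symmetric])
  ultimately show ?case using plus by (simp add: combinations_add)
qed (simp add: combinations.zero)

text \<open>A representation has finitely many terms, hence a largest height.\<close>

lemma combinations_atmost:
  assumes "f \<in> combinations D" "f \<noteq> 0" "\<And>X. X \<in> D \<Longrightarrow> fst X \<in> E"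
  shows "\<exists>Y\<in>D. f \<in> combinations (atmost Y)"
  using assms(1,2)
proof (induction rule: combinations.induct)
  case (plus f g r \<alpha>)
  let ?Z = "shift \<alpha> (lm g)"
  have Z: "(r * mon \<alpha>) *s g \<in> combinations (atmost Y)" if "?Z \<in> atmost Y" for Y
    using plus that by (intro combinations_single)
  have ZZ: "?Z \<in> atmost ?Z" using plus assms(3) by (intro self_atmost) blast
  show ?case
  proof (cases "f = 0")
    case True
    then show ?thesis using Z[OF ZZ] plus by auto
  next
    case False
    then obtain Y where Y: "Y \<in> D" "f \<in> combinations (atmost Y)" using plus by blast
    then consider "?Z \<in> atmost Y" | "Y \<in> atmost ?Z"
      using vord_total[of ?Z Y] assms(3) plus unfolding atmost_def by blast
    then show ?thesis
    proof cases
      case 1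
      with Y show ?thesis by (intro bexI[of _ Y] combinations_add Z)
    next
      case 2
      with Y plus ZZ show ?thesis 
        by (intro bexI[of _ ?Z] combinations_add Z combinations_mono[OF Y(2)] atmost_mono)
    qed
  qed
qed simp

text \<open>For given \<open>g\<close> and \<open>X\<close> at most one \<open>\<alpha>\<close> satisfies \<open>x\<^sup>\<alpha> lm(g) = X\<close>, namely the difference of the exponents.
  So the terms of height exactly \<open>X\<close> can be collected into one term for each element of this set.\<close>

definition divisors :: "expo \<times> 'm \<Rightarrow> ('a ^ 'm) set" where
  "divisors X = {g \<in> G. snd (lm g) = snd X \<and> fst (lm g) \<le> fst X}"

lemma divisorsD:
  assumes "g \<in> divisors X"
  shows "g \<in> G" "g \<noteq> 0" "shift (fst X - fst (lm g)) (lm g) = X"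
  using assms G_neq_0
  by (auto simp: divisors_def shift_def prod_eq_iff fun_eq_iff plus_fun_apply le_fun_def)

lemma divisorsI:
  assumes "g \<in> G" "shift \<alpha> (lm g) = X"
  shows "g \<in> divisors X" "fst X - fst (lm g) = \<alpha>"
  using assms by (auto simp: divisors_def shift_def fun_eq_iff plus_fun_apply le_fun_def)

lemma finite_divisors: "finite (divisors X)"
  using finite_G by (simp add: divisors_def)

lemma combinations_decompose:
  assumes "f \<in> combinations (atmost X)"
  shows "\<exists>r. (\<forall>g. r g \<in> R) \<and>
    f - (\<Sum>g\<in>divisors X. (r g * mon (fst X - fst (lm g))) *s g) \<in> combinations (below X)"
  using assms
proof (induction rule: combinations.induct)
  case zero
  show ?case by (intro exI[of _ "\<lambda>_. 0"]) (simp add: combinations.zero)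
next
  case (plus f g s \<alpha>)
  let ?S = "\<lambda>r. \<Sum>g\<in>divisors X. (r g * mon (fst X - fst (lm g))) *s g"
  obtain r where r: "\<forall>g. r g \<in> R" "f - ?S r \<in> combinations (below X)" using plus by blast
  show ?case
  proof (cases "shift \<alpha> (lm g) = X")
    case True
    let ?r = "\<lambda>h. r h + (if h = g then s else 0)"
    note g = divisorsI[OF plus.hyps(2) True]
    have "(?r h * mon (fst X - fst (lm h))) *s h = (r h * mon (fst X - fst (lm h))) *s h
        + (if h = g then (s * mon \<alpha>) *s g else 0)" for h
      using g by (auto simp: distrib_right vector_sadd_rdistrib)
    then have "?S ?r = ?S r + (s * mon \<alpha>) *s g"
      using g finite_divisors by (simp add: sum.distrib)
    then have "(s * mon \<alpha>) *s g + f - ?S ?r \<in> combinations (below X)"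
      using r by (simp add: algebra_simps)
    moreover have "\<forall>h. ?r h \<in> R" using r plus by simp
    ultimately show ?thesis by (intro exI[of _ ?r] conjI)
  next
    case False
    then have "shift \<alpha> (lm g) \<in> below X" using plus by (simp add: below_iff_atmost)
    then have "(s * mon \<alpha>) *s g + (f - ?S r) \<in> combinations (below X)"
      using plus r by (intro combinations.plus) auto
    with r show ?thesis unfolding add_diff_eq by (intro exI[of _ r] conjI)
  qed
qed

lemma vc_divisors_sum:
  assumes "\<And>g. g \<in> divisors X \<Longrightarrow> r g \<in> R" "fst X \<in> E"
  shows "vc (\<Sum>g\<in>divisors X. (r g * mon (fst X - fst (lm g))) *s g) X
    = (\<Sum>g\<in>divisors X. r g * \<sigma>pow (fst X - fst (lm g)) (lc g) * cc (fst X - fst (lm g)) (fst (lm g)))"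
proof -
  have "vc ((r g * mon (fst X - fst (lm g))) *s g) X
      = r g * \<sigma>pow (fst X - fst (lm g)) (lc g) * cc (fst X - fst (lm g)) (fst (lm g))"
    if "g \<in> divisors X" for g
    using vc_mult_top[of g "r g" "fst X - fst (lm g)"] divisorsD[OF that] assms that by simp
  then show ?thesis by simp
qed


section \<open>Reduction\<close>

abbreviation "step_sum ts \<equiv> (\<Sum>(g, r, \<alpha>)\<leftarrow>ts. (r * mon \<alpha>) *s g)"

lemma step_sum_combination:
  assumes "\<forall>(g, r, \<alpha>)\<in>set ts. g \<in> G \<and> r \<in> R \<and> \<alpha> \<in> E \<and> shift \<alpha> (lm g) \<in> D"
  shows "step_sum ts \<in> combinations D"
  using assms by (induction ts) (auto intro: combinations.intros)

lemma vc_step_sum: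
  assumes "\<forall>(g, r, \<alpha>)\<in>set ts. g \<in> G \<and> r \<in> R \<and> \<alpha> \<in> E \<and> shift \<alpha> (lm g) = X"
  shows "vc (step_sum ts) X = (\<Sum>(g, r, \<alpha>)\<leftarrow>ts. r * \<sigma>pow \<alpha> (lc g) * cc \<alpha> (fst (lm g)))"
  using assms
proof (induction ts)
  case (Cons t ts)
  obtain g r \<alpha> where t: "t = (g, r, \<alpha>)" by (cases t)
  have "vc ((r * mon \<alpha>) *s g) X = r * \<sigma>pow \<alpha> (lc g) * cc \<alpha> (fst (lm g))"
    using vc_mult_top[of g r \<alpha>] Cons.prems G_neq_0 by (auto simp: t)
  with Cons show ?case by (simp add: t)
qed simp

text \<open>The condition on leading coefficients in a reduction step says that the coefficient at \<open>lm(f)\<close>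
  cancels.\<close>

lemma reduction_stepE:
  assumes "reduction_step R n x vord G f h" "f \<noteq> 0"
  obtains "f - h \<in> combinations (atmost (lm f))" "\<And>Y. vc h Y \<noteq> 0 \<Longrightarrow> Y \<in> below (lm f)"
proof -
  obtain ts where ts: "\<forall>(g, r, \<alpha>)\<in>set ts. g \<in> G \<and> r \<in> R \<and> \<alpha> \<in> E \<and>
        snd (lm g) = snd (lm f) \<and> \<alpha> + fst (lm g) = fst (lm f)"
      and lc: "lc f = (\<Sum>(g, r, \<alpha>)\<leftarrow>ts. r * \<sigma>pow \<alpha> (lc g) * cc \<alpha> (fst (lm g)))"
      and h: "h = f - step_sum ts"
    using assms unfolding reduction_step_def by blast
  have shift: "\<forall>(g, r, \<alpha>)\<in>set ts. g \<in> G \<and> r \<in> R \<and> \<alpha> \<in> E \<and> shift \<alpha> (lm g) = lm f"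
    using ts by (auto simp: shift_def prod_eq_iff)
  then have sum_in: "step_sum ts \<in> combinations (atmost (lm f))"
    using self_atmost[OF lm_E[OF assms(2)]] by (intro step_sum_combination) auto
  have "vc h (lm f) = 0"
    using vc_step_sum[OF shift] lc by (simp add: h vec_lc_def)
  moreover have "Y \<in> atmost (lm f)" if "vc h Y \<noteq> 0" for Y
  proof (cases "vc f Y = 0")
    case True
    then show ?thesis
      using that combinations_support[OF sum_in down_closed_atmost, of Y] by (simp add: h)
  qed (rule vc_atmost_lm[OF assms(2)])
  ultimately have "Y \<in> below (lm f)" if "vc h Y \<noteq> 0" for Y
    using that below_iff_atmost by metis
  with sum_in show thesis by (intro that) (simp_all add: h)
qed

text \<open>Each step subtracts terms of height \<open>lm(f)\<close> and leaves a remainder with smaller support, so a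
  reduction to zero adds up to a representation of \<open>f\<close> whose heights are bounded by the support of \<open>f\<close>.\<close>

lemma reduces_to_0_combination:
  assumes "reduces R n x vord G f 0" "\<And>Y. vc f Y \<noteq> 0 \<Longrightarrow> Y \<in> D" "down_closed D"
  shows "f \<in> combinations D"
proof -
  have step: "f - h \<in> combinations D \<and> (\<forall>Y. vc h Y \<noteq> 0 \<longrightarrow> Y \<in> D)"
    if st: "reduction_step R n x vord G f h" and f: "\<And>Y. vc f Y \<noteq> 0 \<Longrightarrow> Y \<in> D" for f h
  proof (cases "f = 0")
    case True
    then have "h = 0" using st by (simp add: reduction_step_def)
    with True show ?thesis by (simp add: combinations.zero)
  next
    case False
    have "lm f \<in> D" using f lc_neq_0[OF False] by (simp add: vec_lc_def)
    then have D: "atmost (lm f) \<subseteq> D" using assms(3) by (simp add: down_closed_def)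
    from st False show ?thesis
      by (rule reduction_stepE) (use D below_atmost[of "lm f"] in \<open>blast intro: combinations_mono\<close>)
  qed
  have "(reduction_step R n x vord G)\<^sup>+\<^sup>+ f 0"
    using assms(1) by (simp add: reduces_def)
  then show ?thesis using assms(2)
  proof (induction rule: converse_tranclp_induct)
    case (base f)
    then show ?case using step[of f 0] by simp
  next
    case (step f h)
    then have "f - h \<in> combinations D" "h \<in> combinations D"
      using \<open>\<And>h f. reduction_step R n x vord G f h \<Longrightarrow> (\<And>Y. vc f Y \<noteq> 0 \<Longrightarrow> Y \<in> D) \<Longrightarrow>
        f - h \<in> combinations D \<and> (\<forall>Y. vc h Y \<noteq> 0 \<longrightarrow> Y \<in> D)\<close>[of f h] by blast+
    then have "(f - h) + h \<in> combinations D" by (rule combinations_add)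
    then show ?case by simp
  qed
qed

lemma groebner_reduces_to_0:
  assumes M: "left_submodule UNIV (*s) M" "G \<subseteq> M"
    and red: "\<And>f. f \<in> M \<Longrightarrow> f \<noteq> 0 \<Longrightarrow> reducible R n x vord G f"
    and "f \<in> M"
  shows "reduces R n x vord G f 0"
proof -
  have M0: "0 \<in> M" and Madd: "\<And>u v. u \<in> M \<Longrightarrow> v \<in> M \<Longrightarrow> u + v \<in> M" and Mscale: "\<And>a u. u \<in> M \<Longrightarrow> a *s u \<in> M"
    using M(1) by (auto simp: left_submodule_def)
  have comb: "h \<in> M" if "h \<in> combinations D" for h D
    using that by (induction rule: combinations.induct) (use M(2) in \<open>auto intro: M0 Madd Mscale\<close>)
  have "\<forall>f. f \<in> M \<longrightarrow> f \<noteq> 0 \<longrightarrow> lm f = X \<longrightarrow> reduces R n x vord G f 0" for X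
  proof (induction X rule: vord_induct)
    case (less X)
    show ?case
    proof (intro allI impI)
      fix f assume f: "f \<in> M" "f \<noteq> 0" "lm f = X"
      then obtain h where h: "reduction_step R n x vord G f h"
        using red unfolding reducible_def by blast
      have fh: "f - h \<in> combinations (atmost (lm f))" and low: "\<And>Y. vc h Y \<noteq> 0 \<Longrightarrow> Y \<in> below (lm f)"
        using h f(2) by (auto elim: reduction_stepE)
      have "f + (- 1) *s (f - h) \<in> M" using f fh comb by (intro Madd Mscale)
      then have hM: "h \<in> M" by (simp add: vector_sneg_minus1[symmetric])
      show "reduces R n x vord G f 0"
      proof (cases "h = 0")
        case True
        with h show ?thesis by (simp add: reduces_def tranclp.r_into_trancl)
      next
        case False
        then have "lm h \<in> below X" using low lc_neq_0[OF False] f by (simp add: vec_lc_def)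
        with less hM False have "reduces R n x vord G h 0" by blast
        with h show ?thesis by (simp add: reduces_def tranclp_into_tranclp2)
      qed
    qed
  qed
  moreover have "reduces R n x vord G 0 0"
    by (simp add: reduces_def reduction_step_def tranclp.r_into_trancl)
  ultimately show ?thesis using \<open>f \<in> M\<close> by (cases "f = 0") auto
qed

lemma reducible_if_top_coeff:
  assumes r: "\<And>g. g \<in> divisors (lm f) \<Longrightarrow> r g \<in> R" and "f \<noteq> 0"
    and lc: "lc f = (\<Sum>g\<in>divisors (lm f). r g * \<sigma>pow (fst (lm f) - fst (lm g)) (lc g)
        * cc (fst (lm f) - fst (lm g)) (fst (lm g)))"
  shows "reducible R n x vord G f"
proof -
  obtain gs where gs: "set gs = divisors (lm f)" "distinct gs"
    using finite_distinct_list[OF finite_divisors] by blast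
  define ts where "ts = map (\<lambda>g. (g, r g, fst (lm f) - fst (lm g))) gs"
  have "\<alpha> + fst (lm g) = fst (lm f) \<and> snd (lm g) = snd (lm f) \<and> g \<in> G \<and> r' \<in> R \<and> \<alpha> \<in> E"
    if "(g, r', \<alpha>) \<in> set ts" for g r' \<alpha>
  proof -
    have g: "g \<in> divisors (lm f)" "r' = r g" "\<alpha> = fst (lm f) - fst (lm g)"
      using that gs by (auto simp: ts_def)
    with divisorsD[OF g(1)] r lm_E[OF \<open>f \<noteq> 0\<close>] show ?thesis
      by (auto simp: shift_def prod_eq_iff)
  qed
  moreover have "lc f = (\<Sum>(g, r, \<alpha>)\<leftarrow>ts. r * \<sigma>pow \<alpha> (lc g) * cc \<alpha> (fst (lm g)))"
    unfolding lc ts_def by (simp add: comp_def gs sum_list_distinct_conv_sum_set flip: gs(1))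
  ultimately have "reduction_step R n x vord G f (f - step_sum ts)"
    unfolding reduction_step_def using \<open>f \<noteq> 0\<close> by (intro disjI2 conjI exI[of _ ts]) auto
  with \<open>f \<noteq> 0\<close> show ?thesis unfolding reducible_def by blast
qed

section \<open>The criterion\<close>

lemma critical_lcm_divisors:
  assumes "fst X \<in> E" "divisors X \<noteq> {}"
  obtains L where "critical_lcm R n x vord (divisors X) = Some (L, snd X)" "L \<in> E" "L \<le> fst X"
    "\<And>g. g \<in> divisors X \<Longrightarrow> fst (lm g) \<le> L"
proof -
  let ?S = "lm ` divisors X"
  define L where "L = (\<lambda>k. Max ((\<lambda>Y. fst Y k) ` ?S))"
  have fin: "finite ?S" using finite_divisors by simp
  have "snd ` ?S = {snd X}"
    using assms(2) by (auto simp: divisors_def image_iff)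
  then have "critical_lcm R n x vord (divisors X) = Some (L, snd X)"
    by (simp add: critical_lcm_def mon_lcm_def L_def)
  moreover have le: "L \<le> fst X"
    unfolding L_def le_fun_def using fin assms(2) by (auto simp: divisors_def le_fun_def)
  moreover have "L \<in> E" using le assms(1) by (auto simp: exponents_def le_fun_def) (metis le_zero_eq)
  moreover have "fst (lm g) \<le> L" if "g \<in> divisors X" for g
    unfolding L_def le_fun_def using fin that by (auto intro!: Max_ge)
  ultimately show thesis by (intro that)
qed

lemma family_sum_apply: "(\<Sum>b\<in>I. c b) g = (\<Sum>b\<in>I. c b g)" for c :: "'b \<Rightarrow> 'c \<Rightarrow> 'd::comm_monoid_add"
  by (induction I rule: infinite_finite_induct) (simp_all add: plus_fun_apply zero_fun_apply)

lemma generator_in_span: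
  assumes "finite B" "b \<in> B"
  shows "b \<in> left_span R scale_family B"
proof -
  have "b = (\<Sum>v\<in>B. scale_family (if v = b then 1 else 0) v)"
  proof
    fix g
    have "(\<Sum>v\<in>B. scale_family (if v = b then 1 else 0) v) g = (\<Sum>v\<in>B. if v = b then v g else 0)"
      unfolding family_sum_apply scale_family_def by (intro sum.cong) auto
    then show "b g = (\<Sum>v\<in>B. scale_family (if v = b then 1 else 0) v) g"
      using assms by simp
  qed
  then show ?thesis unfolding left_span_def by (intro CollectI exI[of _ "\<lambda>v. if v = b then 1 else 0"]) auto
qed

text \<open>If the terms of height \<open>X\<close> cancel, their sum has a representation of smaller height.  The proof
  divides the relation between their coefficients by \<open>x\<^sup>\<delta>\<close>, which gives the syzygy \<open>t\<close> at \<open>X\<^sub>F\<close>, and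
  multiplies back after the criterion has been applied to the generators of the syzygy module.\<close>

lemma cancel_top:
  assumes B: "\<And>F. F \<subseteq> G \<Longrightarrow> critical_lcm R n x vord F \<noteq> None \<Longrightarrow>
      finite (B F) \<and> left_span R scale_family (B F) = critical_syz R n x vord F"
    and red: "\<And>F b. F \<subseteq> G \<Longrightarrow> critical_lcm R n x vord F \<noteq> None \<Longrightarrow> b \<in> B F \<Longrightarrow>
      reduces R n x vord G (\<Sum>g\<in>F. (b g * mon (cofactor_exp R n x vord F g)) *s g) 0"
    and X: "fst X \<in> E" and r: "\<And>g. g \<in> divisors X \<Longrightarrow> r g \<in> R"
    and top: "(\<Sum>g\<in>divisors X. r g * \<sigma>pow (fst X - fst (lm g)) (lc g)
        * cc (fst X - fst (lm g)) (fst (lm g))) = 0"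
  shows "(\<Sum>g\<in>divisors X. (r g * mon (fst X - fst (lm g))) *s g) \<in> combinations (below X)"
proof (cases "divisors X = {}")
  case True
  then show ?thesis by (simp add: combinations.zero)
next
  case False
  let ?F = "divisors X"
  obtain L where L: "critical_lcm R n x vord ?F = Some (L, snd X)" "L \<in> E" "L \<le> fst X"
    and L_ge: "\<And>g. g \<in> ?F \<Longrightarrow> fst (lm g) \<le> L"
    using critical_lcm_divisors[OF X False] by blast
  have FG: "?F \<subseteq> G" by (auto simp: divisors_def)
  have crit: "critical_lcm R n x vord ?F \<noteq> None" using L by simp
  define \<gamma> where "\<gamma> g = cofactor_exp R n x vord ?F g" for g
  define \<delta> where "\<delta> = fst X - L"
  have \<gamma>: "\<gamma> g = L - fst (lm g)" for g by (simp add: \<gamma>_def cofactor_exp_def L)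
  have \<delta>E: "\<delta> \<in> E" and \<gamma>E: "\<gamma> g \<in> E" for g using X L by (simp_all add: \<delta>_def \<gamma>)
  have \<delta>L: "\<delta> + L = fst X"
    using L(3) by (simp add: \<delta>_def fun_eq_iff le_fun_def plus_fun_apply)
  have \<gamma>lm: "\<gamma> g + fst (lm g) = L" and \<delta>\<gamma>: "\<delta> + \<gamma> g = fst X - fst (lm g)" if "g \<in> ?F" for g
    using L_ge[OF that] L(3) by (simp_all add: \<gamma> \<delta>_def fun_eq_iff le_fun_def plus_fun_apply)
  have lmE: "fst (lm g) \<in> E" if "g \<in> ?F" for g using lm_E divisorsD[OF that] by blast
  have shift_L: "shift (\<gamma> g) (lm g) = (L, snd X)" if "g \<in> ?F" for g
    using \<gamma>lm[OF that] that by (simp add: shift_def divisors_def)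
  let ?s = "\<lambda>g. \<sigma>pow (\<gamma> g) (lc g) * cc (\<gamma> g) (fst (lm g))"

  \<comment> \<open>dividing a coefficient by \<open>x\<^sup>\<delta>\<close> requires units \<open>c\<close> and surjectivity of \<open>\<sigma>\<^sup>\<delta>\<close>\<close>
  have "\<exists>t\<in>R. \<sigma>pow \<delta> t * cc \<delta> (\<gamma> g) = r g" if g: "g \<in> ?F" for g
  proof -
    obtain v where v: "v \<in> R" "v * cc \<delta> (\<gamma> g) = 1"
      using pbw_c_unit[OF \<delta>E \<gamma>E, of g] unfolding R_units_def by blast
    then obtain t where "t \<in> R" "\<sigma>pow \<delta> t = r g * v"
      using bij_sigma_pow[OF \<delta>E] R_mult[OF r[OF g] v(1)] unfolding bij_betw_def by (metis imageE)
    with v show ?thesis by (metis mult.assoc mult_1_right)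
  qed
  then obtain t0 where t0: "\<And>g. g \<in> ?F \<Longrightarrow> t0 g \<in> R \<and> \<sigma>pow \<delta> (t0 g) * cc \<delta> (\<gamma> g) = r g"
    by metis
  define t where "t g = (if g \<in> ?F then t0 g else 0)" for g
  have tR: "t g \<in> R" and tr: "g \<in> ?F \<Longrightarrow> \<sigma>pow \<delta> (t g) * cc \<delta> (\<gamma> g) = r g" for g
    using t0 by (simp_all add: t_def)

  \<comment> \<open>\<open>\<sigma>\<^sup>\<delta>\<close> maps this sum to the given relation up to the unit \<open>c\<^bsub>\<delta>,L\<^esub>\<close>, and \<open>\<sigma>\<^sup>\<delta>\<close> is injective\<close>
  have "(\<Sum>g\<in>?F. t g * ?s g) = 0"
  proof -
    have sR: "t g * ?s g \<in> R" if "g \<in> ?F" for g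
      using tR \<gamma>E lmE[OF that] by simp
    have "\<sigma>pow \<delta> (\<Sum>g\<in>?F. t g * ?s g) * cc \<delta> L
        = (\<Sum>g\<in>?F. \<sigma>pow \<delta> (t g) * (\<sigma>pow \<delta> (?s g) * cc \<delta> (\<gamma> g + fst (lm g))))"
      using sR \<delta>E \<gamma>E lmE tR \<gamma>lm
      by (simp add: sigma_pow_sum sigma_pow_mult sum_distrib_right mult.assoc)
    also have "\<dots> = (\<Sum>g\<in>?F. r g * \<sigma>pow (fst X - fst (lm g)) (lc g) * cc (fst X - fst (lm g)) (fst (lm g)))"
    proof (rule sum.cong)
      fix g assume g: "g \<in> ?F"
      have "\<sigma>pow \<delta> (t g) * (\<sigma>pow \<delta> (?s g) * cc \<delta> (\<gamma> g + fst (lm g)))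
          = (\<sigma>pow \<delta> (t g) * cc \<delta> (\<gamma> g)) * \<sigma>pow (\<delta> + \<gamma> g) (lc g) * cc (\<delta> + \<gamma> g) (fst (lm g))"
        using cocycle[OF \<delta>E \<gamma>E lmE[OF g] lc_R, of g g] by (simp add: mult.assoc)
      then show "\<sigma>pow \<delta> (t g) * (\<sigma>pow \<delta> (?s g) * cc \<delta> (\<gamma> g + fst (lm g)))
          = r g * \<sigma>pow (fst X - fst (lm g)) (lc g) * cc (fst X - fst (lm g)) (fst (lm g))"
        using tr[OF g] \<delta>\<gamma>[OF g] by simp
    qed simp
    finally have "\<sigma>pow \<delta> (\<Sum>g\<in>?F. t g * ?s g) = 0"
      using R_units_cancel_right[OF pbw_c_unit[OF \<delta>E L(2)]] top by simp
    also have "0 = \<sigma>pow \<delta> 0" using \<delta>E by (simp add: sigma_pow_0)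
    finally show ?thesis
      by (rule inj_onD[OF bij_betw_imp_inj_on[OF bij_sigma_pow[OF \<delta>E]] _ R_sum[OF sR] R_0])
  qed
  moreover have "t g = 0" if "g \<notin> ?F" for g using that by (simp add: t_def)
  ultimately have "t \<in> critical_syz R n x vord ?F"
    using tR by (simp add: critical_syz_def Syz_def \<gamma>_def)
  then obtain c where c: "\<forall>b\<in>B ?F. c b \<in> R" "t = (\<Sum>b\<in>B ?F. scale_family (c b) b)"
    using B[OF FG crit] unfolding left_span_def by blast
  have t_eq: "t g = (\<Sum>b\<in>B ?F. c b * b g)" for g
    by (simp add: c(2) family_sum_apply scale_family_def)

  \<comment> \<open>\<open>b\<close> is a syzygy, so the support of \<open>?S b\<close> lies strictly below \<open>X\<^sub>F\<close>, and so do the heights\<close>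
  let ?S = "\<lambda>b. \<Sum>g\<in>?F. (b g * mon (\<gamma> g)) *s g"
  have S_in: "?S b \<in> combinations (below (L, snd X))" if b: "b \<in> B ?F" for b
  proof (rule reduces_to_0_combination[OF _ _ down_closed_below])
    show "reduces R n x vord G (?S b) 0"
      using red[OF FG crit b] by (simp add: \<gamma>_def)
    have "b \<in> critical_syz R n x vord ?F"
      using B[OF FG crit] generator_in_span b by blast
    then have bR: "\<And>g. g \<in> ?F \<Longrightarrow> b g \<in> R" and b0: "(\<Sum>g\<in>?F. b g * ?s g) = 0"
      by (simp_all add: critical_syz_def Syz_def \<gamma>_def)
    have "?S b \<in> combinations (atmost (L, snd X))"
      using shift_L bR \<gamma>E divisorsD L(2) self_atmost[of "(L, snd X)"]
      by (intro combinations_sum combinations_single) auto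
    moreover have "vc (?S b) (L, snd X) = (\<Sum>g\<in>?F. b g * ?s g)"
      unfolding vc_sum
    proof (rule sum.cong)
      fix g assume g: "g \<in> ?F"
      show "vc ((b g * mon (\<gamma> g)) *s g) (L, snd X) = b g * ?s g"
        using vc_mult_top[OF divisorsD(2)[OF g] bR[OF g] \<gamma>E, of g] shift_L[OF g]
        by (simp add: mult.assoc)
    qed simp
    ultimately show "Y \<in> below (L, snd X)" if "vc (?S b) Y \<noteq> 0" for Y
      using that b0 combinations_support[OF _ down_closed_atmost, of "?S b" "(L, snd X)" Y]
      unfolding below_iff_atmost by metis
  qed

  have T: "(\<Sum>g\<in>?F. (t g * mon (\<gamma> g)) *s g) = (\<Sum>b\<in>B ?F. c b *s ?S b)"
  proof -
    have "(\<Sum>g\<in>?F. (t g * mon (\<gamma> g)) *s g) = (\<Sum>g\<in>?F. \<Sum>b\<in>B ?F. c b *s ((b g * mon (\<gamma> g)) *s g))"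
      by (simp add: t_eq sum_distrib_right smult_sum_left vector_smult_assoc mult.assoc)
    also have "\<dots> = (\<Sum>b\<in>B ?F. c b *s ?S b)"
      by (subst sum.swap) (simp add: smult_sum_right)
    finally show ?thesis .
  qed
  have "(\<Sum>g\<in>?F. (t g * mon (\<gamma> g)) *s g) \<in> combinations (below (L, snd X))"
    unfolding T using c(1) by (intro combinations_sum combinations_scale S_in) auto
  from mon_smult_combinations[OF this \<delta>E] L(2)
  have lifted: "mon \<delta> *s (\<Sum>g\<in>?F. (t g * mon (\<gamma> g)) *s g) \<in> combinations (below X)"
    by (simp add: shift_def \<delta>L)

  \<comment> \<open>the error of replacing \<open>x\<^sup>\<delta> t\<^sub>g x\<^bsup>\<gamma>\<^esup>\<close> by its leading term\<close>
  define p where "p g = mon \<delta> * (t g * mon (\<gamma> g)) - r g * mon (fst X - fst (lm g))" for g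
  have "p g *s g \<in> combinations (below X)" if g: "g \<in> ?F" for g
  proof (rule combinations_deg_below)
    show "p g \<in> deg_below (deg \<delta> + deg (\<gamma> g))"
      using mon_mult_term[OF \<delta>E \<gamma>E tR, of g g] tr[OF g] \<delta>\<gamma>[OF g] by (simp add: p_def)
    have "deg \<delta> + deg (\<gamma> g) + deg (fst (lm g)) = deg (\<delta> + (\<gamma> g + fst (lm g)))" by simp
    then show "deg \<delta> + deg (\<gamma> g) + deg (fst (lm g)) \<le> deg (fst X)"
      by (simp only: \<gamma>lm[OF g] \<delta>L order_refl)
  qed (use divisorsD(1)[OF g] X in auto)
  then have "(\<Sum>g\<in>?F. p g *s g) \<in> combinations (below X)" by (rule combinations_sum)
  moreover have "(\<Sum>g\<in>?F. (r g * mon (fst X - fst (lm g))) *s g)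
      = mon \<delta> *s (\<Sum>g\<in>?F. (t g * mon (\<gamma> g)) *s g) - (\<Sum>g\<in>?F. p g *s g)"
    unfolding smult_sum_right sum_subtractf[symmetric]
    by (intro sum.cong) (simp_all add: p_def vector_smult_assoc vec_eq_iff algebra_simps)
  ultimately show ?thesis using lifted combinations_diff by simp
qed

text \<open>Induction on the height \<open>X\<close> of a representation.  The coefficient of \<open>f\<close> at \<open>X\<close> decides: if it is
  non-zero the terms of height \<open>X\<close> reduce \<open>f\<close>, otherwise they cancel and the height can be lowered.\<close>

lemma combination_reducible:
  assumes cancel: "\<And>X r. fst X \<in> E \<Longrightarrow> (\<And>g. g \<in> divisors X \<Longrightarrow> r g \<in> R) \<Longrightarrow>
      (\<Sum>g\<in>divisors X. r g * \<sigma>pow (fst X - fst (lm g)) (lc g) * cc (fst X - fst (lm g)) (fst (lm g))) = 0 \<Longrightarrow>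
      (\<Sum>g\<in>divisors X. (r g * mon (fst X - fst (lm g))) *s g) \<in> combinations (below X)"
    and "f \<noteq> 0" "fst X \<in> E" "f \<in> combinations (atmost X)"
  shows "reducible R n x vord G f"
  using assms(3,4)
proof (induction X rule: vord_induct)
  case (less X)
  let ?S = "\<lambda>r. \<Sum>g\<in>divisors X. (r g * mon (fst X - fst (lm g))) *s g"
  let ?k = "\<lambda>r. \<Sum>g\<in>divisors X. r g * \<sigma>pow (fst X - fst (lm g)) (lc g) * cc (fst X - fst (lm g)) (fst (lm g))"
  obtain r where r: "\<And>g. r g \<in> R" "f - ?S r \<in> combinations (below X)"
    using combinations_decompose[OF less.prems(2)] by blast
  have "vc f X = ?k r"
    using combinations_below_vc_0[OF r(2)] vc_divisors_sum[of X r] r(1) less.prems(1) by simp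
  show ?case
  proof (cases "?k r = 0")
    case True
    then have "?S r \<in> combinations (below X)" using cancel less.prems(1) r(1) by simp
    from combinations_add[OF r(2) this] have "f \<in> combinations (below X)" by simp
    then obtain Y where "Y \<in> below X" "f \<in> combinations (atmost Y)"
      using combinations_atmost[of f "below X"] \<open>f \<noteq> 0\<close> below_E by blast
    with less.IH below_E show ?thesis by blast
  next
    case False
    then have "lm f = X"
      using combinations_support[OF less.prems(2) down_closed_atmost] \<open>vc f X = ?k r\<close>
      by (intro lm_eqI) auto
    with r(1) \<open>f \<noteq> 0\<close> \<open>vc f X = ?k r\<close> show ?thesis
      by (intro reducible_if_top_coeff[where r = r]) (simp_all add: vec_lc_def)
  qed
qed

lemma span_combination:
  assumes "f \<in> left_span UNIV (*s) G"
  shows "f \<in> combinations (E \<times> UNIV)"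
proof -
  obtain c where "f = (\<Sum>g\<in>G. c g *s g)" using assms unfolding left_span_def by blast
  moreover have "c g *s g \<in> combinations (E \<times> UNIV)" if "g \<in> G" for g
    unfolding smult_expand[of "c g"]
    using that by (intro combinations_sum combinations_single) 
      (auto simp: mem_Times_iff lm_E G_neq_0 dest: coeff_E)
  ultimately show ?thesis by (simp add: combinations_sum)
qed

end

lemma bijective_skew_pbwI: "bijective_skew_pbw_extension R n x \<Longrightarrow> bijective_skew_pbw R n x"
  unfolding bijective_skew_pbw_extension_def bijective_skew_pbw_def skew_pbw_def
    bijective_skew_pbw_axioms_def by blast

lemma pbw_moduleI:
  assumes "bijective_skew_pbw_extension R n x" "pbw_monomial_order R n x ord"
    "pbw_vec_monomial_order R n x ord vord"
  shows "pbw_module R n x vord"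
proof -
  interpret bijective_skew_pbw R n x by (rule bijective_skew_pbwI[OF assms(1)])
  note v = assms(3)[unfolded pbw_vec_monomial_order_def]
  show ?thesis
  proof
    show lin: "linear_order_on (exponents n \<times> UNIV) vord" using v by blast
    fix X Y :: "expo \<times> 'b"
    show "(X, Y) \<in> vord" if "fst X \<in> E" "fst Y \<in> E" "deg (fst X) < deg (fst Y)"
      using v that by (metis prod.collapse)
    fix \<gamma> assume XY: "(X, Y) \<in> vord" and \<gamma>: "\<gamma> \<in> E"
    have "vord \<subseteq> (E \<times> UNIV) \<times> (E \<times> UNIV)"
      using lin by (auto simp: linear_order_on_def partial_order_on_def preorder_on_def refl_on_def)
    with XY have "fst X \<in> E" "fst Y \<in> E" by auto
    moreover have "((pbw_lm R n x ord (mon \<gamma> * mon (fst X)), snd X),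
        (pbw_lm R n x ord (mon \<gamma> * mon (fst Y)), snd Y)) \<in> vord"
      using v XY \<gamma> by (metis prod.collapse)
    ultimately show "(shift \<gamma> X, shift \<gamma> Y) \<in> vord"
      using pbw_lm_mon_mult[OF assms(2)] \<gamma> by (simp add: shift_def)
  qed
qed

theorem theorem115:
  fixes R :: "'a::ring_1 set" and n :: nat and x :: "nat \<Rightarrow> 'a"
    and ord :: "expo rel" and vord :: "(expo \<times> 'm::finite) rel"
    and M G :: "('a ^ 'm) set"
    and B :: "('a ^ 'm) set \<Rightarrow> ('a ^ 'm \<Rightarrow> 'a) set"
  assumes "bijective_skew_pbw_extension R n x"
    and "left_groebner_soluble R"
    and "pbw_monomial_order R n x ord"
    and "pbw_vec_monomial_order R n x ord vord"
    and "left_submodule UNIV (*s) M" and "M \<noteq> {0}"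
    and "finite G" and "G \<subseteq> M - {0}" and "left_span UNIV (*s) G = M"
    and "\<And>F. F \<subseteq> G \<Longrightarrow> critical_lcm R n x vord F \<noteq> None \<Longrightarrow>
           finite (B F) \<and> left_span R scale_family (B F) = critical_syz R n x vord F"
  shows "groebner_basis R n x vord G M \<longleftrightarrow>
    (\<forall>F\<subseteq>G. critical_lcm R n x vord F \<noteq> None \<longrightarrow>
       (\<forall>b\<in>B F. reduces R n x vord G
          (\<Sum>g\<in>F. (b g * pbw_mon n x (cofactor_exp R n x vord F g)) *s g) 0))"
    (is "?gb \<longleftrightarrow> ?crit")
proof -
  interpret pbw_generators R n x vord G
    using pbw_moduleI[OF assms(1,3,4)] assms(7,8)
    unfolding pbw_generators_def pbw_generators_axioms_def by blast
  show ?thesis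
  proof
    assume gb: ?gb
    have red: "reducible R n x vord G f" if "f \<in> M" "f \<noteq> 0" for f
      using gb assms(6) that by (simp add: groebner_basis_def)
    have sum_M: "(\<Sum>g\<in>F. c g *s g) \<in> M" if "F \<subseteq> G" for F c
    proof -
      have "finite F" using that assms(7) by (rule finite_subset)
      then show ?thesis using that assms(5,8)
        by (induction F rule: finite_induct) (auto simp: left_submodule_def)
    qed
    have GM: "G \<subseteq> M" using assms(8) by blast
    show ?crit
      by (intro allI impI ballI groebner_reduces_to_0[OF assms(5) GM red] sum_M)
  next
    assume crit: ?crit
    have "reducible R n x vord G f" if f: "f \<in> M" "f \<noteq> 0" for f
    proof -
      have "f \<in> combinations (E \<times> UNIV)" using f assms(9) by (intro span_combination) simp
      then obtain X where "fst X \<in> E" "f \<in> combinations (atmost X)"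
        using combinations_atmost[of f "E \<times> UNIV"] f(2) by auto
      then show ?thesis
        using crit f(2) by (intro combination_reducible[OF cancel_top[OF assms(10)]]) auto
    qed
    moreover have "G \<noteq> {}" using assms(6,9) by (auto simp: left_span_def)
    ultimately show ?gb using assms(6,7,8) by (auto simp: groebner_basis_def)
  qed
qed

end
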